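(* Let $M$ be a compact $d$-dimensional differentiable manifold without boundary, $T\in(0,\infty)$, and let $(g_t)_{t\in[0,T]}$ be a family of Riemannian metrics on $M$ which is $C^1$ in $t$. Suppose that $k\in C([0,T])$ satisfies $\mathcal R_t\ge -k(t)$ for all $t\in[0,T]$, where $\mathcal R_t:=\mathrm{Ric}_t+\partial_t g_t$. Let $u:M\times[0,T]\to\mathbb R$ be a smooth positive solution of the heat equation $\partial_t u=\tfrac12\Delta u$ on $M\times[0,T]$. Then for all $x\in M$ and $t\in(0,T]$, $$\frac{|\nabla u|^2}{u^2}(x,t)\le \frac{2}{\int_0^t e^{-\int_s^t k(r)\,dr}\,ds}\,\log\frac{\|u\|_{M\times[0,T]}}{u(x,t)}.$$
   Context: $\mathrm{Ric}_t$ is the Ricci curvature tensor of $g_t$. The gradient $\nabla$, the norm $|\cdot|$ and the Laplacian $\Delta$ at time $t$ are taken with respect to $g_t$. The inequality $\mathcal R_t\ge -k(t)$ means $\mathcal R_t(X,X)\ge -k(t)\,g_t(X,X)$ for all tangent vectors $X$. For a function $f$ and a set $D\subset M\times[0,T]$, $\|f\|_D:=\sup_{(x,t)\in D}|f(x,t)|$. *)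

theory Defs
  imports "HOL-Analysis.Analysis"
begin

text \<open>
  \<open>S\<close> is meant to be an open set, or an open set times a nondegenerate compact interval
  \<open>V \<times> {0..T}\<close>. In both cases derivatives within \<open>S\<close> are unique; in the second case they are
  one-sided in the last variable at its end points, so that \<open>smooth_on\<close> is
  smoothness up to the boundary.
\<close>

primrec Ck_on :: "nat \<Rightarrow> 'a::euclidean_space set \<Rightarrow> ('a \<Rightarrow> 'b::real_normed_vector) \<Rightarrow> bool" where
  "Ck_on 0 S f \<longleftrightarrow> continuous_on S f"
| "Ck_on (Suc n) S f \<longleftrightarrow>
     (\<exists>f'. (\<forall>x\<in>S. (f has_derivative f' x) (at x within S)) \<and> (\<forall>v. Ck_on n S (\<lambda>x. f' x v)))"

definition smooth_on :: "'a::euclidean_space set \<Rightarrow> ('a \<Rightarrow> 'b::real_normed_vector) \<Rightarrow> bool" where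
  "smooth_on S f \<longleftrightarrow> (\<forall>n. Ck_on n S f)"

definition partial_deriv :: "'d::finite \<Rightarrow> (real^'d \<Rightarrow> real) \<Rightarrow> real^'d \<Rightarrow> real" where
  "partial_deriv i f x = frechet_derivative f (at x) (axis i 1)"

text \<open>
  A chart is a pair \<open>(U, \<phi>)\<close>; the values of \<open>\<phi>\<close> outside \<open>U\<close> are irrelevant.
  The manifold \<open>M\<close> is a subspace of a Hausdorff space \<open>'m\<close>, its dimension is \<open>CARD('d)\<close>.
\<close>

type_synonym ('m, 'd) chart = "'m set \<times> ('m \<Rightarrow> real^'d)"

definition chart_image :: "('m, 'd::finite) chart \<Rightarrow> (real^'d) set" where
  "chart_image c = snd c ` fst c"

definition chart_inv :: "('m, 'd::finite) chart \<Rightarrow> real^'d \<Rightarrow> 'm" where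
  "chart_inv c = inv_into (fst c) (snd c)"

definition smooth_atlas :: "'m::t2_space set \<Rightarrow> ('m, 'd::finite) chart set \<Rightarrow> bool" where
  "smooth_atlas M A \<longleftrightarrow>
     (\<forall>c\<in>A. openin (top_of_set M) (fst c) \<and> open (chart_image c) \<and>
            homeomorphism (fst c) (chart_image c) (snd c) (chart_inv c)) \<and>
     (\<Union>c\<in>A. fst c) = M \<and>
     (\<forall>c\<in>A. \<forall>c'\<in>A. smooth_on (snd c ` (fst c \<inter> fst c')) (snd c' \<circ> chart_inv c))"

definition charts_at :: "('m, 'd::finite) chart set \<Rightarrow> 'm \<Rightarrow> ('m, 'd) chart set" where
  "charts_at A p = {c \<in> A. p \<in> fst c}"

text \<open>The differential at the coordinates of \<open>p\<close> of the change of coordinates from \<open>c\<close> to \<open>c'\<close>.\<close>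

definition transition_deriv ::
    "('m, 'd::finite) chart \<Rightarrow> ('m, 'd) chart \<Rightarrow> 'm \<Rightarrow> real^'d \<Rightarrow> real^'d" where
  "transition_deriv c c' p = frechet_derivative (snd c' \<circ> chart_inv c) (at (snd c p))"

text \<open>
  A tangent vector at \<open>p\<close> is given by its coordinate vectors \<open>X c\<close> in all charts \<open>c\<close> around \<open>p\<close>,
  which transform by the differentials of the changes of coordinates. On all other
  charts \<open>X\<close> is set to \<open>0\<close>, so that equality of tangent vectors is equality of functions.
\<close>

type_synonym ('m, 'd) tvec = "('m, 'd) chart \<Rightarrow> real^'d"

definition tangent_space :: "('m, 'd::finite) chart set \<Rightarrow> 'm \<Rightarrow> ('m, 'd) tvec set" where
  "tangent_space A p =
     {X. (\<forall>c\<in>charts_at A p. \<forall>c'\<in>charts_at A p. X c' = transition_deriv c c' p (X c)) \<and>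
         (\<forall>c. c \<notin> charts_at A p \<longrightarrow> X c = 0)}"

text \<open>The coordinate vector \<open>\<partial>\<^sub>i\<close> of the chart \<open>c\<close> at \<open>p\<close>.\<close>

definition coord_vec ::
    "('m, 'd::finite) chart set \<Rightarrow> ('m, 'd) chart \<Rightarrow> 'm \<Rightarrow> 'd \<Rightarrow> ('m, 'd) tvec" where
  "coord_vec A c p i =
     (\<lambda>c'. if c' \<in> charts_at A p then transition_deriv c c' p (axis i 1) else 0)"

type_synonym ('m, 'd) bilinear_field = "'m \<Rightarrow> ('m, 'd) tvec \<Rightarrow> ('m, 'd) tvec \<Rightarrow> real"

definition metric_coeff ::
    "('m, 'd::finite) chart set \<Rightarrow> ('m, 'd) bilinear_field \<Rightarrow> ('m, 'd) chart \<Rightarrow> real^'d \<Rightarrow> real^'d^'d"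
  where
  "metric_coeff A h c x =
     (\<chi> i j. h (chart_inv c x) (coord_vec A c (chart_inv c x) i) (coord_vec A c (chart_inv c x) j))"

definition riemannian_metric ::
    "'m::t2_space set \<Rightarrow> ('m, 'd::finite) chart set \<Rightarrow> ('m, 'd) bilinear_field \<Rightarrow> bool" where
  "riemannian_metric M A h \<longleftrightarrow>
     (\<forall>p\<in>M. \<forall>X\<in>tangent_space A p. \<forall>Y\<in>tangent_space A p. \<forall>Z\<in>tangent_space A p. \<forall>a b.
        h p (\<lambda>c. a *\<^sub>R X c + b *\<^sub>R Y c) Z = a * h p X Z + b * h p Y Z) \<and>
     (\<forall>p\<in>M. \<forall>X\<in>tangent_space A p. \<forall>Y\<in>tangent_space A p. h p X Y = h p Y X) \<and>
     (\<forall>p\<in>M. \<forall>X\<in>tangent_space A p. X \<noteq> (\<lambda>c. 0) \<longrightarrow> h p X X > 0) \<and>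
     (\<forall>c\<in>A. \<forall>i j. smooth_on (chart_image c) (\<lambda>x. metric_coeff A h c x $ i $ j))"

text \<open>
  The family is \<open>C\<^sup>1\<close> in \<open>t\<close>: the coefficients \<open>g\<^sub>i\<^sub>j(x,t)\<close> and their derivatives \<open>\<partial>\<^sub>tg\<^sub>i\<^sub>j(x,t)\<close>
  (one-sided at \<open>t = 0\<close> and \<open>t = T\<close>) are continuous in \<open>(x,t)\<close>. No joint regularity of the
  derivatives of \<open>g\<^sub>i\<^sub>j\<close> in \<open>x\<close> is required.
\<close>

definition C1_metric_family ::
    "'m::t2_space set \<Rightarrow> ('m, 'd::finite) chart set \<Rightarrow> real \<Rightarrow> (real \<Rightarrow> ('m, 'd) bilinear_field) \<Rightarrow> bool"
  where
  "C1_metric_family M A T g \<longleftrightarrow>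
     (\<forall>t\<in>{0..T}. riemannian_metric M A (g t)) \<and>
     (\<forall>c\<in>A. \<forall>i j.
        continuous_on (chart_image c \<times> {0..T}) (\<lambda>(x, t). metric_coeff A (g t) c x $ i $ j) \<and>
        (\<exists>g'. continuous_on (chart_image c \<times> {0..T}) (\<lambda>(x, t). g' x t) \<and>
              (\<forall>x\<in>chart_image c. \<forall>t\<in>{0..T}.
                 ((\<lambda>s. metric_coeff A (g s) c x $ i $ j) has_real_derivative g' x t)
                   (at t within {0..T}))))"

definition metric_time_deriv ::
    "real \<Rightarrow> (real \<Rightarrow> ('m, 'd::finite) bilinear_field) \<Rightarrow> real \<Rightarrow> ('m, 'd) bilinear_field" where
  "metric_time_deriv T g t p X Y = vector_derivative (\<lambda>s. g s p X Y) (at t within {0..T})"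

definition metric_coeff_inv ::
    "('m, 'd::finite) chart set \<Rightarrow> ('m, 'd) bilinear_field \<Rightarrow> ('m, 'd) chart \<Rightarrow> real^'d \<Rightarrow> real^'d^'d"
  where
  "metric_coeff_inv A h c x = matrix_inv (metric_coeff A h c x)"

text \<open>The Christoffel symbol \<open>\<Gamma>\<^sup>k\<^sub>i\<^sub>j\<close> of the Levi-Civita connection in the chart \<open>c\<close>.\<close>

definition christoffel ::
    "('m, 'd::finite) chart set \<Rightarrow> ('m, 'd) bilinear_field \<Rightarrow> ('m, 'd) chart \<Rightarrow>
     'd \<Rightarrow> 'd \<Rightarrow> 'd \<Rightarrow> real^'d \<Rightarrow> real" where
  "christoffel A h c k i j x =
     (1/2) * (\<Sum>l\<in>UNIV. metric_coeff_inv A h c x $ k $ l *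
        (partial_deriv i (\<lambda>y. metric_coeff A h c y $ j $ l) x
         + partial_deriv j (\<lambda>y. metric_coeff A h c y $ i $ l) x
         - partial_deriv l (\<lambda>y. metric_coeff A h c y $ i $ j) x))"

text \<open>
  The coefficient \<open>R\<^sup>l\<^sub>k\<^sub>i\<^sub>j\<close> of the curvature tensor: \<open>R(\<partial>\<^sub>i,\<partial>\<^sub>j)\<partial>\<^sub>k = \<Sum>\<^sub>l R\<^sup>l\<^sub>k\<^sub>i\<^sub>j \<partial>\<^sub>l\<close> with
  \<open>R(X,Y)Z = \<nabla>\<^sub>X\<nabla>\<^sub>YZ - \<nabla>\<^sub>Y\<nabla>\<^sub>XZ - \<nabla>\<^bsub>[X,Y]\<^esub>Z\<close>.
\<close>

definition curvature_coeff ::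
    "('m, 'd::finite) chart set \<Rightarrow> ('m, 'd) bilinear_field \<Rightarrow> ('m, 'd) chart \<Rightarrow>
     'd \<Rightarrow> 'd \<Rightarrow> 'd \<Rightarrow> 'd \<Rightarrow> real^'d \<Rightarrow> real" where
  "curvature_coeff A h c l k i j x =
     partial_deriv i (christoffel A h c l j k) x - partial_deriv j (christoffel A h c l i k) x
     + (\<Sum>m\<in>UNIV. christoffel A h c l i m x * christoffel A h c m j k x
                  - christoffel A h c l j m x * christoffel A h c m i k x)"

text \<open>
  The Ricci curvature at \<open>p\<close>, \<open>Ric(X,Y) = tr(Z \<mapsto> R(Z,X)Y)\<close>, evaluated in a chart \<open>c\<close> around \<open>p\<close>;
  its value does not depend on \<open>c\<close>. With this sign the round spheres have positive
  Ricci curvature.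
\<close>

definition ricci ::
    "('m, 'd::finite) chart set \<Rightarrow> ('m, 'd) bilinear_field \<Rightarrow> ('m, 'd) chart \<Rightarrow> ('m, 'd) bilinear_field"
  where
  "ricci A h c p X Y =
     (\<Sum>j\<in>UNIV. \<Sum>k\<in>UNIV. (\<Sum>i\<in>UNIV. curvature_coeff A h c i k i j (snd c p)) * X c $ j * Y c $ k)"

text \<open>
  The Laplace-Beltrami operator as the trace of the Hessian, i.e.
  \<open>\<Delta>f = \<Sum>\<^sub>i\<^sub>j g\<^sup>i\<^sup>j (\<partial>\<^sub>i\<partial>\<^sub>jf - \<Sum>\<^sub>k \<Gamma>\<^sup>k\<^sub>i\<^sub>j \<partial>\<^sub>kf)\<close>, evaluated in a chart \<open>c\<close> around \<open>p\<close>; its value does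
  not depend on \<open>c\<close>.
\<close>

definition laplacian ::
    "('m, 'd::finite) chart set \<Rightarrow> ('m, 'd) bilinear_field \<Rightarrow> ('m, 'd) chart \<Rightarrow>
     ('m \<Rightarrow> real) \<Rightarrow> 'm \<Rightarrow> real" where
  "laplacian A h c f p =
     (let x = snd c p; F = f \<circ> chart_inv c in
      \<Sum>i\<in>UNIV. \<Sum>j\<in>UNIV. metric_coeff_inv A h c x $ i $ j *
        (partial_deriv i (partial_deriv j F) x
         - (\<Sum>k\<in>UNIV. christoffel A h c k i j x * partial_deriv k F x)))"

text \<open>The gradient is the tangent vector \<open>X\<close> with \<open>h(X,Y) = df(Y)\<close> for all tangent vectors \<open>Y\<close>.\<close>

definition gradient ::
    "('m, 'd::finite) chart set \<Rightarrow> ('m, 'd) bilinear_field \<Rightarrow> ('m \<Rightarrow> real) \<Rightarrow> 'm \<Rightarrow> ('m, 'd) tvec" where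
  "gradient A h f p =
     (THE X. X \<in> tangent_space A p \<and>
        (\<forall>Y\<in>tangent_space A p. \<forall>c\<in>charts_at A p.
           h p X Y = frechet_derivative (f \<circ> chart_inv c) (at (snd c p)) (Y c)))"

definition metric_norm :: "('m, 'd::finite) bilinear_field \<Rightarrow> 'm \<Rightarrow> ('m, 'd) tvec \<Rightarrow> real" where
  "metric_norm h p X = sqrt (h p X X)"

definition smooth_spacetime ::
    "('m, 'd::finite) chart set \<Rightarrow> real \<Rightarrow> ('m \<Rightarrow> real \<Rightarrow> real) \<Rightarrow> bool" where
  "smooth_spacetime A T u \<longleftrightarrow>
     (\<forall>c\<in>A. smooth_on (chart_image c \<times> {0..T}) (\<lambda>(x, t). u (chart_inv c x) t))"

definition heat_solution ::
    "('m, 'd::finite) chart set \<Rightarrow> real \<Rightarrow> (real \<Rightarrow> ('m, 'd) bilinear_field) \<Rightarrow>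
     ('m \<Rightarrow> real \<Rightarrow> real) \<Rightarrow> bool" where
  "heat_solution A T g u \<longleftrightarrow>
     (\<forall>c\<in>A. \<forall>p\<in>fst c. \<forall>t\<in>{0..T}.
        ((\<lambda>s. u p s) has_real_derivative (1/2) * laplacian A (g t) c (\<lambda>q. u q t) p)
          (at t within {0..T}))"

definition sup_norm_on :: "('m \<times> real) set \<Rightarrow> ('m \<Rightarrow> real \<Rightarrow> real) \<Rightarrow> real" where
  "sup_norm_on D f = (SUP z\<in>D. \<bar>f (fst z) (snd z)\<bar>)"

end

theory Submission
  imports Defs
begin

text \<open>
  Write \<open>w = ln u\<close>, \<open>N = |\<nabla>w|\<^sup>2\<close> and \<open>\<phi>(t) = 1/2 \<integral>\<^sub>0\<^sup>t exp (- \<integral>\<^sub>s\<^sup>t k) ds\<close>, so that \<open>\<phi>' = 1/2 - k \<phi>\<close>.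
  The heat equation becomes \<open>\<partial>\<^sub>tw = (\<Delta>w + N)/2\<close>. With Bochner's formula and the curvature bound,
  \<open>Q = \<phi> N + w\<close> satisfies \<open>\<partial>\<^sub>tQ \<le> \<Delta>Q/2 + \<langle>\<nabla>w, \<nabla>Q\<rangle>\<close>, so the maximum principle bounds \<open>Q\<close> by the
  supremum of its initial value \<open>ln u(\<cdot>,0)\<close>. No joint regularity of the space
  derivatives of the metrics is needed, since \<open>\<partial>\<^sub>tQ\<close> involves only the values of \<open>g\<^sup>i\<^sup>j\<close>.
\<close>

section \<open>Smooth functions and commuting derivatives\<close>

text \<open>The rate \<phi>' = 1/2 - k \<phi> is forced. Bochner's formula writes half the Laplacian
  of N as |Hess w|^2 + <grad w, grad lap w> + Ric(grad w, grad w), and the moving metric adds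
  -(dg/dt)(grad w, grad w) to dN/dt. Hence lap Q / 2 + <grad w, grad Q> - dQ/dt equals \<phi> (|Hess
  w|^2 + (Ric + dg/dt)(grad w, grad w)) + (1/2 - \<phi>') N, and the choice of \<phi>' makes the
  last term k \<phi> N, which is what the curvature bound can absorb. The value \<phi>(0) = 0
  removes the gradient at time 0, where nothing bounds it. Two points shape the formal proof.
  Derivatives in x and t are exchanged on an open piece of spacetime, so the evolution inequality is
  stated for 0 < t < T and time T is reached by continuity. And all computations are local, whereas
  the maximum principle needs one function on M: Q is therefore defined through the gradient and
  only afterwards identified with its expression in each chart.\<close>

lemma Ck_on_cong:
  assumes "Ck_on n S f" "\<And>x. x \<in> S \<Longrightarrow> f x = g x"
  shows "Ck_on n S g"
proof (cases n)
  case 0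
  then show ?thesis using assms by (simp cong: continuous_on_cong)
next
  case (Suc m)
  then obtain f' where "\<forall>x\<in>S. (f has_derivative f' x) (at x within S)" "\<forall>v. Ck_on m S (\<lambda>x. f' x v)"
    using assms(1) by auto
  moreover have "(g has_derivative f' x) (at x within S)"
    if "x \<in> S" "(f has_derivative f' x) (at x within S)" for x
    using has_derivative_transform[OF that(1) _ that(2), of g] assms(2) by simp
  ultimately show ?thesis using Suc by auto
qed

lemma Ck_on_SucD: "Ck_on (Suc n) S f \<Longrightarrow> Ck_on n S f"
proof (induction n arbitrary: f)
  case 0
  then show ?case by (auto intro: has_derivative_continuous_on)
next
  case (Suc n)
  then show ?case by (metis Ck_on.simps(2))
qed

lemma Ck_on_subset: "Ck_on n S f \<Longrightarrow> U \<subseteq> S \<Longrightarrow> Ck_on n U f"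
proof (induction n arbitrary: f)
  case 0
  then show ?case by (auto intro: continuous_on_subset)
next
  case (Suc n)
  then obtain f' where "\<forall>x\<in>S. (f has_derivative f' x) (at x within S)" "\<forall>v. Ck_on n S (\<lambda>x. f' x v)"
    by auto
  then show ?case using Suc by (auto intro!: exI[of _ f'] has_derivative_subset[of _ _ _ S U])
qed

lemma Ck_on_const: "Ck_on n S (\<lambda>x. c)"
proof (induction n arbitrary: c)
  case (Suc n)
  then show ?case by (auto intro!: exI[of _ "\<lambda>x v. 0"])
qed simp

lemma Ck_on_add:
  assumes "Ck_on n S f" "Ck_on n S g"
  shows "Ck_on n S (\<lambda>x. f x + g x)"
  using assms
proof (induction n arbitrary: f g)
  case 0
  then show ?case by (auto intro: continuous_intros)
next
  case (Suc n)
  then obtain f' g' where "\<forall>x\<in>S. (f has_derivative f' x) (at x within S)" "\<forall>v. Ck_on n S (\<lambda>x. f' x v)"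
    "\<forall>x\<in>S. (g has_derivative g' x) (at x within S)" "\<forall>v. Ck_on n S (\<lambda>x. g' x v)"
    by auto
  then show ?case using Suc.IH
    by (auto intro!: exI[of _ "\<lambda>x v. f' x v + g' x v"] has_derivative_add)
qed

text \<open>The derivative of a product contains the factors themselves, which the induction needs
  at one order lower; \<open>Ck_on_SucD\<close> supplies them.\<close>

lemma Ck_on_mult:
  fixes f g :: "'a::euclidean_space \<Rightarrow> real"
  assumes "Ck_on n S f" "Ck_on n S g"
  shows "Ck_on n S (\<lambda>x. f x * g x)"
  using assms
proof (induction n arbitrary: f g)
  case 0
  then show ?case by (auto intro: continuous_intros)
next
  case (Suc n)
  obtain f' g' where *: "\<forall>x\<in>S. (f has_derivative f' x) (at x within S)" "\<forall>v. Ck_on n S (\<lambda>x. f' x v)"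
    "\<forall>x\<in>S. (g has_derivative g' x) (at x within S)" "\<forall>v. Ck_on n S (\<lambda>x. g' x v)"
    using Suc.prems by auto
  have "Ck_on n S f" "Ck_on n S g" using Suc.prems Ck_on_SucD by auto
  then have "\<forall>v. Ck_on n S (\<lambda>x. f x * g' x v + f' x v * g x)"
    using * Suc.IH by (auto intro!: Ck_on_add)
  moreover have "\<forall>x\<in>S. ((\<lambda>x. f x * g x) has_derivative (\<lambda>v. f x * g' x v + f' x v * g x)) (at x within S)"
    using * by (auto intro!: has_derivative_mult)
  ultimately show ?case by (auto intro!: exI[of _ "\<lambda>x v. f x * g' x v + f' x v * g x"])
qed

lemma Ck_on_inverse:
  fixes f :: "'a::euclidean_space \<Rightarrow> real"
  assumes "Ck_on n S f" "\<And>x. x \<in> S \<Longrightarrow> f x \<noteq> 0"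
  shows "Ck_on n S (\<lambda>x. inverse (f x))"
  using assms
proof (induction n arbitrary: f)
  case 0
  then show ?case by (auto intro: continuous_intros)
next
  case (Suc n)
  obtain f' where *: "\<forall>x\<in>S. (f has_derivative f' x) (at x within S)" "\<forall>v. Ck_on n S (\<lambda>x. f' x v)"
    using Suc.prems by auto
  have "Ck_on n S (\<lambda>x. inverse (f x))" using Suc.IH Suc.prems Ck_on_SucD by blast
  then have "Ck_on n S (\<lambda>x. (- 1) * (inverse (f x) * f' x v * inverse (f x)))" for v
    using * by (intro Ck_on_mult Ck_on_const) auto
  then have "\<forall>v. Ck_on n S (\<lambda>x. - (inverse (f x) * f' x v * inverse (f x)))" by simp
  moreover have "\<forall>x\<in>S. ((\<lambda>x. inverse (f x)) has_derivative (\<lambda>v. - (inverse (f x) * f' x v * inverse (f x)))) (at x within S)"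
    using * Suc.prems by (auto intro!: has_derivative_inverse)
  ultimately show ?case
    by (auto intro!: exI[of _ "\<lambda>x v. - (inverse (f x) * f' x v * inverse (f x))"])
qed

text \<open>No induction is necessary: the derivative \<open>f' / f\<close> falls under the rules
  for products and inverses.\<close>

lemma Ck_on_ln:
  fixes f :: "'a::euclidean_space \<Rightarrow> real"
  assumes "Ck_on n S f" "\<And>x. x \<in> S \<Longrightarrow> f x > 0"
  shows "Ck_on n S (\<lambda>x. ln (f x))"
proof (cases n)
  case 0
  then show ?thesis using assms by (auto intro!: continuous_intros) (metis less_irrefl)
next
  case (Suc m)
  obtain f' where *: "\<forall>x\<in>S. (f has_derivative f' x) (at x within S)" "\<forall>v. Ck_on m S (\<lambda>x. f' x v)"
    using assms Suc by auto
  have "Ck_on m S f" using assms(1) Suc Ck_on_SucD by blast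
  then have "Ck_on m S (\<lambda>x. inverse (f x))" using assms(2)
    by (intro Ck_on_inverse) force+
  then have "\<forall>v. Ck_on m S (\<lambda>x. f' x v * inverse (f x))"
    using * by (auto intro!: Ck_on_mult)
  moreover have "((\<lambda>x. ln (f x)) has_derivative (\<lambda>v. f' x v * inverse (f x))) (at x within S)"
    if "x \<in> S" for x
    using * assms(2) that
    by (auto intro!: derivative_eq_intros simp: divide_inverse mult.commute)
  ultimately show ?thesis using Suc by (auto intro!: exI[of _ "\<lambda>x v. f' x v * inverse (f x)"])
qed

text \<open>Freezes the time. Since the derivatives are taken within \<open>U \<times> I\<close>,
  this also covers the end points of a time interval, where the derivative is one-sided.\<close>

lemma Ck_on_slice:
  fixes f :: "'a::euclidean_space \<times> 'b::euclidean_space \<Rightarrow> 'c::real_normed_vector"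
  assumes "Ck_on n (U \<times> I) f" "t \<in> I"
  shows "Ck_on n U (\<lambda>x. f (x, t))"
  using assms(1)
proof (induction n arbitrary: f)
  case 0
  have "continuous_on U (\<lambda>x. (x, t))" by (intro continuous_intros)
  from continuous_on_compose2[OF _ this, of "U \<times> I" f] show ?case using 0 assms(2) by force
next
  case (Suc n)
  then obtain f' where *: "\<forall>x\<in>U \<times> I. (f has_derivative f' x) (at x within U \<times> I)"
    "\<forall>v. Ck_on n (U \<times> I) (\<lambda>x. f' x v)"
    by auto
  have "((\<lambda>x. f (x, t)) has_derivative (\<lambda>v. f' (x, t) (v, 0))) (at x within U)" if "x \<in> U" for x
  proof -
    have 1: "((\<lambda>x. (x, t)) has_derivative (\<lambda>v. (v, 0))) (at x within U)"
      by (intro has_derivative_Pair has_derivative_ident has_derivative_const)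
    have "(f has_derivative f' (x, t)) (at (x, t) within (\<lambda>x. (x, t)) ` U)"
      using that assms(2) by (intro has_derivative_subset[OF bspec[OF *(1)], of "(x, t)"]) auto
    from has_derivative_in_compose[OF 1 this] show ?thesis .
  qed
  moreover have "\<forall>v. Ck_on n U (\<lambda>x. f' (x, t) (v, 0))"
    using *(2) Suc.IH by auto
  ultimately show ?case by (auto intro!: exI[of _ "\<lambda>x v. f' (x, t) (v, 0)"])
qed

lemma smooth_on_cong: "smooth_on S f \<Longrightarrow> (\<And>x. x \<in> S \<Longrightarrow> f x = g x) \<Longrightarrow> smooth_on S g"
  unfolding smooth_on_def using Ck_on_cong by blast

lemma smooth_on_subset: "smooth_on S f \<Longrightarrow> U \<subseteq> S \<Longrightarrow> smooth_on U f"
  unfolding smooth_on_def using Ck_on_subset by blast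

lemma smooth_on_const: "smooth_on S (\<lambda>x. c)"
  by (simp add: smooth_on_def Ck_on_const)

lemma smooth_on_add: "smooth_on S f \<Longrightarrow> smooth_on S g \<Longrightarrow> smooth_on S (\<lambda>x. f x + g x)"
  by (simp add: smooth_on_def Ck_on_add)

lemma smooth_on_mult:
  fixes f g :: "'a::euclidean_space \<Rightarrow> real"
  shows "smooth_on S f \<Longrightarrow> smooth_on S g \<Longrightarrow> smooth_on S (\<lambda>x. f x * g x)"
  by (simp add: smooth_on_def Ck_on_mult)

lemma smooth_on_inverse:
  fixes f :: "'a::euclidean_space \<Rightarrow> real"
  shows "smooth_on S f \<Longrightarrow> (\<And>x. x \<in> S \<Longrightarrow> f x \<noteq> 0) \<Longrightarrow> smooth_on S (\<lambda>x. inverse (f x))"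
  by (simp add: smooth_on_def Ck_on_inverse)

lemma smooth_on_ln:
  fixes f :: "'a::euclidean_space \<Rightarrow> real"
  shows "smooth_on S f \<Longrightarrow> (\<And>x. x \<in> S \<Longrightarrow> f x > 0) \<Longrightarrow> smooth_on S (\<lambda>x. ln (f x))"
  by (simp add: smooth_on_def Ck_on_ln)

lemma smooth_on_minus:
  fixes f :: "'a::euclidean_space \<Rightarrow> real"
  shows "smooth_on S f \<Longrightarrow> smooth_on S (\<lambda>x. - f x)"
  using smooth_on_mult[OF smooth_on_const[of S "-1"], of f] by simp

lemma smooth_on_diff:
  fixes f g :: "'a::euclidean_space \<Rightarrow> real"
  shows "smooth_on S f \<Longrightarrow> smooth_on S g \<Longrightarrow> smooth_on S (\<lambda>x. f x - g x)"
  using smooth_on_add[OF _ smooth_on_minus, of S f g] by simp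

lemma smooth_on_sum:
  "(\<And>i. i \<in> I \<Longrightarrow> smooth_on S (f i)) \<Longrightarrow> smooth_on S (\<lambda>x. \<Sum>i\<in>I. f i x)"
  by (induction I rule: infinite_finite_induct) (simp_all add: smooth_on_const smooth_on_add)

lemma smooth_on_prod:
  fixes f :: "'i \<Rightarrow> 'a::euclidean_space \<Rightarrow> real"
  shows "(\<And>i. i \<in> I \<Longrightarrow> smooth_on S (f i)) \<Longrightarrow> smooth_on S (\<lambda>x. \<Prod>i\<in>I. f i x)"
  by (induction I rule: infinite_finite_induct) (simp_all add: smooth_on_const smooth_on_mult)

lemma smooth_on_slice:
  fixes f :: "'a::euclidean_space \<times> 'b::euclidean_space \<Rightarrow> 'c::real_normed_vector"
  shows "smooth_on (U \<times> I) f \<Longrightarrow> t \<in> I \<Longrightarrow> smooth_on U (\<lambda>x. f (x, t))"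
  by (auto simp: smooth_on_def intro: Ck_on_slice)

lemma smooth_on_imp_continuous_on: "smooth_on S f \<Longrightarrow> continuous_on S f"
  by (metis smooth_on_def Ck_on.simps(1))

section \<open>Derivatives of smooth functions on open sets\<close>

lemma smooth_on_imp_has_derivative:
  assumes "open S" "smooth_on S f" "x \<in> S"
  shows "(f has_derivative frechet_derivative f (at x)) (at x)"
proof -
  have "Ck_on (Suc 0) S f" using assms smooth_on_def by blast
  then show ?thesis using assms
    by (metis Ck_on.simps(2) at_within_open differentiableI frechet_derivative_works)
qed

lemma smooth_on_frechet_derivative:
  assumes "open S" "smooth_on S f"
  shows "smooth_on S (\<lambda>x. frechet_derivative f (at x) v)"
  unfolding smooth_on_def
proof
  fix n
  obtain f' where *: "\<forall>x\<in>S. (f has_derivative f' x) (at x within S)" "\<forall>v. Ck_on n S (\<lambda>x. f' x v)"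
    using assms(2) unfolding smooth_on_def by (metis Ck_on.simps(2))
  have "f' x v = frechet_derivative f (at x) v" if "x \<in> S" for x
    using *(1) that assms by (metis at_within_open frechet_derivative_at)
  then show "Ck_on n S (\<lambda>x. frechet_derivative f (at x) v)"
    using Ck_on_cong[OF spec[OF *(2), of v]] by simp
qed

lemma smooth_on_line_derivative:
  assumes "open S" "smooth_on S f" "a + r *\<^sub>R v \<in> S"
  shows "((\<lambda>r. f (a + r *\<^sub>R v)) has_vector_derivative frechet_derivative f (at (a + r *\<^sub>R v)) v) (at r)"
proof -
  have "(f has_derivative frechet_derivative f (at (a + r *\<^sub>R v))) (at (a + r *\<^sub>R v))"
    using smooth_on_imp_has_derivative assms by blast
  moreover have "((\<lambda>r. a + r *\<^sub>R v) has_vector_derivative v) (at r)"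
    by (auto intro!: derivative_eq_intros)
  ultimately show ?thesis
    using vector_derivative_diff_chain_within[of "\<lambda>r. a + r *\<^sub>R v" v r UNIV f]
    by (auto simp: o_def intro: has_derivative_at_withinI)
qed

text \<open>Both sides are the limit of the second difference
  \<open>(f (x + h v + h w) - f (x + h v) - f (x + h w) + f x) / h\<^sup>2\<close>.\<close>

lemma frechet_derivative_commute_aux:
  fixes f :: "'a::euclidean_space \<Rightarrow> real"
  assumes "open S" "smooth_on S f" "h > 0"
    and S: "\<And>r s. 0 \<le> r \<Longrightarrow> r \<le> h \<Longrightarrow> 0 \<le> s \<Longrightarrow> s \<le> h \<Longrightarrow> x + r *\<^sub>R v + s *\<^sub>R w \<in> S"
  obtains r s where "0 < r" "r < h" "0 < s" "s < h"
    "f (x + h *\<^sub>R v + h *\<^sub>R w) - f (x + h *\<^sub>R v) - f (x + h *\<^sub>R w) + f x =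
       h * h * frechet_derivative (\<lambda>y. frechet_derivative f (at y) v) (at (x + r *\<^sub>R v + s *\<^sub>R w)) w"
proof -
  \<comment> \<open>The difference of \<open>f\<close> across the side \<open>h w\<close>. The mean
    value theorem along v, and then along w, leads to the mixed derivative at an inner point of the
    parallelogram.\<close>
  define \<phi> where "\<phi> r = f ((x + h *\<^sub>R w) + r *\<^sub>R v) - f (x + r *\<^sub>R v)" for r
  have "(\<phi> has_real_derivative frechet_derivative f (at ((x + h *\<^sub>R w) + r *\<^sub>R v)) v
      - frechet_derivative f (at (x + r *\<^sub>R v)) v) (at r)" if "0 \<le> r" "r \<le> h" for r
  proof -
    have "x + h *\<^sub>R w + r *\<^sub>R v \<in> S" "x + r *\<^sub>R v \<in> S"
      using S[of r h] S[of r 0] that assms by (simp_all add: add.assoc add.commute[of "h *\<^sub>R w"])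
    then show ?thesis
      unfolding \<phi>_def using assms
      by (intro DERIV_diff)
        (simp_all add: has_real_derivative_iff_has_vector_derivative smooth_on_line_derivative)
  qed
  from MVT2[OF \<open>h > 0\<close> this]
  obtain r where r: "0 < r" "r < h" "\<phi> h - \<phi> 0 = h * (frechet_derivative f (at ((x + h *\<^sub>R w) + r *\<^sub>R v)) v
      - frechet_derivative f (at (x + r *\<^sub>R v)) v)"
    by auto
  have sm: "smooth_on S (\<lambda>y. frechet_derivative f (at y) v)"
    using smooth_on_frechet_derivative assms by blast
  have "((\<lambda>s. frechet_derivative f (at ((x + r *\<^sub>R v) + s *\<^sub>R w)) v) has_real_derivative
      frechet_derivative (\<lambda>y. frechet_derivative f (at y) v) (at ((x + r *\<^sub>R v) + s *\<^sub>R w)) w) (at s)"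
    if "0 \<le> s" "s \<le> h" for s
    using smooth_on_line_derivative[OF assms(1) sm, of "x + r *\<^sub>R v" s w] S[of r s] that r
    by (auto simp: has_real_derivative_iff_has_vector_derivative)
  from MVT2[OF \<open>h > 0\<close> this] obtain s where s: "0 < s" "s < h"
    "frechet_derivative f (at ((x + r *\<^sub>R v) + h *\<^sub>R w)) v - frechet_derivative f (at ((x + r *\<^sub>R v))) v =
      h * frechet_derivative (\<lambda>y. frechet_derivative f (at y) v) (at ((x + r *\<^sub>R v) + s *\<^sub>R w)) w"
    by auto
  show ?thesis
  proof (rule that[OF r(1,2) s(1,2)])
    have "f (x + h *\<^sub>R v + h *\<^sub>R w) - f (x + h *\<^sub>R v) - f (x + h *\<^sub>R w) + f x = \<phi> h - \<phi> 0"
      by (simp add: \<phi>_def algebra_simps)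
    also have "\<dots> = h * (frechet_derivative f (at ((x + r *\<^sub>R v) + h *\<^sub>R w)) v - frechet_derivative f (at ((x + r *\<^sub>R v))) v)"
      using r by (simp add: algebra_simps)
    finally show "f (x + h *\<^sub>R v + h *\<^sub>R w) - f (x + h *\<^sub>R v) - f (x + h *\<^sub>R w) + f x =
       h * h * frechet_derivative (\<lambda>y. frechet_derivative f (at y) v) (at (x + r *\<^sub>R v + s *\<^sub>R w)) w"
      by (simp add: s)
  qed
qed

lemma frechet_derivative_commute:
  fixes f :: "'a::euclidean_space \<Rightarrow> real"
  assumes "open S" "smooth_on S f" "x \<in> S"
  shows "frechet_derivative (\<lambda>y. frechet_derivative f (at y) v) (at x) w =
         frechet_derivative (\<lambda>y. frechet_derivative f (at y) w) (at x) v"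
proof (rule ccontr)
  define a where "a v w x = frechet_derivative (\<lambda>y. frechet_derivative f (at y) v) (at x) w" for v w x
  assume "\<not> ?thesis"
  then have ne: "a v w x \<noteq> a w v x" by (simp add: a_def)
  \<comment> \<open>Half of the gap: two values that each lie within \<open>e\<close> of their own
    limit cannot coincide.\<close>
  define e where "e = \<bar>a v w x - a w v x\<bar> / 2"
  have "e > 0" using ne by (simp add: e_def)
  have cont: "continuous_on S (a v w)" for v w
    unfolding a_def using assms
    by (intro smooth_on_imp_continuous_on smooth_on_frechet_derivative)
  have "\<exists>d>0. \<forall>y. dist y x < d \<longrightarrow> y \<in> S \<and> dist (a v w y) (a v w x) < e" for v w
  proof -
    obtain d1 where "d1 > 0" "\<And>y. dist y x < d1 \<Longrightarrow> y \<in> S"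
      using assms by (auto simp: open_dist)
    moreover obtain d2 where "d2 > 0" "\<And>y. y \<in> S \<Longrightarrow> dist y x < d2 \<Longrightarrow> dist (a v w y) (a v w x) < e"
      using cont[of v w] assms(3) \<open>e > 0\<close> unfolding continuous_on_iff by blast
    ultimately show ?thesis by (intro exI[of _ "min d1 d2"]) auto
  qed
  from this[of v w] this[of w v] obtain d1 d2 where d: "d1 > 0" "d2 > 0"
    "\<And>y. dist y x < d1 \<Longrightarrow> y \<in> S \<and> dist (a v w y) (a v w x) < e"
    "\<And>y. dist y x < d2 \<Longrightarrow> y \<in> S \<and> dist (a w v y) (a w v x) < e"
    by blast
  define d where "d = min d1 d2"
  \<comment> \<open>Small enough to keep the parallelogram spanned by \<open>h v\<close> and
    \<open>h w\<close> within distance d of x; the summand 1 keeps the denominator positive.\<close>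
  define h where "h = d / (norm v + norm w + 1) / 2"
  have dpos: "d > 0" using d by (simp add: d_def)
  have npos: "norm v + norm w + 1 > 0" by (simp add: add_nonneg_pos)
  then have "h > 0" using dpos by (simp add: h_def)
  have near: "dist (x + r *\<^sub>R v + s *\<^sub>R w) x < d" if "0 \<le> r" "r \<le> h" "0 \<le> s" "s \<le> h" for r s
  proof -
    have "dist (x + r *\<^sub>R v + s *\<^sub>R w) x = norm (r *\<^sub>R v + s *\<^sub>R w)"
      by (simp add: dist_norm algebra_simps)
    also have "\<dots> \<le> r * norm v + s * norm w"
      using norm_triangle_ineq[of "r *\<^sub>R v" "s *\<^sub>R w"] that by simp
    also have "\<dots> \<le> h * norm v + h * norm w"
      using that by (intro add_mono mult_right_mono) auto
    also have "\<dots> < h * (norm v + norm w + 1)"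
      using \<open>h > 0\<close> by (simp add: algebra_simps)
    also have "\<dots> = d / 2" using npos by (simp add: h_def field_simps)
    finally show ?thesis using dpos by simp
  qed
  have inS: "x + r *\<^sub>R v + s *\<^sub>R w \<in> S" if "0 \<le> r" "r \<le> h" "0 \<le> s" "s \<le> h" for r s
    using near[OF that] d by (auto simp: d_def)
  have inS': "x + r *\<^sub>R w + s *\<^sub>R v \<in> S" if "0 \<le> r" "r \<le> h" "0 \<le> s" "s \<le> h" for r s
    using inS[OF that(3,4,1,2)] by (simp add: algebra_simps)
  obtain r s where 1: "0 < r" "r < h" "0 < s" "s < h"
    "f (x + h *\<^sub>R v + h *\<^sub>R w) - f (x + h *\<^sub>R v) - f (x + h *\<^sub>R w) + f x = h * h * a v w (x + r *\<^sub>R v + s *\<^sub>R w)"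
    using frechet_derivative_commute_aux[OF assms(1,2) \<open>h > 0\<close> inS] unfolding a_def by blast
  obtain r' s' where 2: "0 < r'" "r' < h" "0 < s'" "s' < h"
    "f (x + h *\<^sub>R w + h *\<^sub>R v) - f (x + h *\<^sub>R w) - f (x + h *\<^sub>R v) + f x = h * h * a w v (x + r' *\<^sub>R w + s' *\<^sub>R v)"
    using frechet_derivative_commute_aux[OF assms(1,2) \<open>h > 0\<close> inS'] unfolding a_def by blast
  \<comment> \<open>The second difference is symmetric in v and w, so the two mixed derivatives
    agree at two points near x.\<close>
  have "x + h *\<^sub>R w + h *\<^sub>R v = x + h *\<^sub>R v + h *\<^sub>R w" by (simp add: algebra_simps)
  then have "h * h * a v w (x + r *\<^sub>R v + s *\<^sub>R w) = h * h * a w v (x + r' *\<^sub>R w + s' *\<^sub>R v)"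
    unfolding 1(5)[symmetric] 2(5)[symmetric] by (simp only: add.commute diff_diff_eq)
  then have "a v w (x + r *\<^sub>R v + s *\<^sub>R w) = a w v (x + r' *\<^sub>R w + s' *\<^sub>R v)"
    using \<open>h > 0\<close> by simp
  also have "x + r' *\<^sub>R w + s' *\<^sub>R v = x + s' *\<^sub>R v + r' *\<^sub>R w"
    by (simp add: algebra_simps)
  finally have "a v w (x + r *\<^sub>R v + s *\<^sub>R w) = a w v (x + s' *\<^sub>R v + r' *\<^sub>R w)" .
  moreover have "dist (a v w (x + r *\<^sub>R v + s *\<^sub>R w)) (a v w x) < e"
    using d(3) near[of r s] 1 by (simp add: d_def)
  moreover have "dist (a w v (x + s' *\<^sub>R v + r' *\<^sub>R w)) (a w v x) < e"
    using d(4) near[of s' r'] 2 by (simp add: d_def)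
  ultimately have "\<bar>a v w x - a w v x\<bar> < 2 * e"
    unfolding dist_real_def by linarith
  then show False by (simp add: e_def)
qed

section \<open>Positive semidefinite forms and partial derivatives\<close>

text \<open>The trace of a product of two semidefinite forms. Splitting off from \<open>G\<close>
  the rank-one form \<open>G k i * G k j / G k k\<close> leaves a semidefinite form on the smaller
  index set, and the pairing of a rank-one form with \<open>A\<close> is a value of
  \<open>A\<close>. It serves twice: for |Hess w|^2 and for the sign of the Laplacian at a
  maximum.\<close>

lemma sum_mult_psd_nonneg:
  fixes G A :: "'i \<Rightarrow> 'i \<Rightarrow> real"
  assumes "finite I"
    and "\<And>i j. i \<in> I \<Longrightarrow> j \<in> I \<Longrightarrow> G i j = G j i"
    and "\<And>c. 0 \<le> (\<Sum>i\<in>I. \<Sum>j\<in>I. G i j * (c i * c j))"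
    and "\<And>c. 0 \<le> (\<Sum>i\<in>I. \<Sum>j\<in>I. A i j * (c i * c j))"
  shows "0 \<le> (\<Sum>i\<in>I. \<Sum>j\<in>I. G i j * A i j)"
  using assms
proof (induction I arbitrary: G rule: finite_induct)
  case (insert k I)
  let ?J = "insert k I"
  text \<open>One step of the Cholesky decomposition. If \<open>G k k = 0\<close> then the whole row \<open>G k\<close>
    vanishes and the division by zero is harmless.\<close>
  define G' where "G' i j = G i j - G k i * G k j / G k k" for i j
  have sym: "G i j = G j i" if "i \<in> ?J" "j \<in> ?J" for i j
    using insert.prems(1) that by blast
  have row: "G k i = 0" if "i \<in> ?J" "G k k = 0" for i
  proof (rule ccontr)
    assume ne: "G k i \<noteq> 0"
    with that have i: "i \<in> I" "i \<noteq> k" by auto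
    \<comment> \<open>Solves \<open>2 * s * G k i + G i i = -1\<close>, the value of the form at s
      times the k-th plus the i-th unit vector.\<close>
    define s where "s = - (G i i + 1) / (2 * G k i)"
    define c where "c j = (if j = k then s else if j = i then 1 else 0)" for j
    have "(\<Sum>j\<in>?J. G l j * (c l * c j)) = c l * (s * G l k + G l i)" if "l \<in> ?J" for l
    proof -
      have "(\<Sum>j\<in>I. G l j * (c l * c j)) = (\<Sum>j\<in>I. if j = i then G l i * c l else 0)"
        using insert.hyps(2) i by (intro sum.cong) (auto simp: c_def)
      also have "\<dots> = G l i * c l" using i insert.hyps(1) by simp
      finally show ?thesis
        using insert.hyps by (simp add: c_def algebra_simps)
    qed
    then have "(\<Sum>l\<in>?J. \<Sum>j\<in>?J. G l j * (c l * c j)) = (\<Sum>l\<in>?J. c l * (s * G l k + G l i))"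
      by simp
    also have "\<dots> = s * G k i + (\<Sum>l\<in>I. c l * (s * G l k + G l i))"
      using insert.hyps that by (simp add: c_def)
    also have "(\<Sum>l\<in>I. c l * (s * G l k + G l i)) = (\<Sum>l\<in>I. if l = i then s * G i k + G i i else 0)"
      using insert.hyps(2) i by (intro sum.cong) (auto simp: c_def)
    also have "\<dots> = s * G k i + G i i" using i insert.hyps(1) sym[of i k] by simp
    finally have "(\<Sum>l\<in>?J. \<Sum>j\<in>?J. G l j * (c l * c j)) = 2 * (s * G k i) + G i i" by simp
    also have "\<dots> = - 1" using ne by (simp add: s_def field_simps)
    finally show False using insert.prems(2)[of c] by simp
  qed
  have decomp: "G i j = G k i * G k j / G k k + G' i j" for i j
    by (simp add: G'_def)
  have zero: "G' k j = 0" "G' j k = 0" if "j \<in> ?J" for j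
    using row[OF that] sym[of j k] that by (auto simp: G'_def)
  have red: "(\<Sum>i\<in>?J. \<Sum>j\<in>?J. G i j * B i j) =
      (\<Sum>i\<in>?J. \<Sum>j\<in>?J. B i j * (G k i * G k j)) / G k k + (\<Sum>i\<in>I. \<Sum>j\<in>I. G' i j * B i j)" for B
  proof -
    have "(\<Sum>i\<in>?J. \<Sum>j\<in>?J. G i j * B i j) =
       (\<Sum>i\<in>?J. \<Sum>j\<in>?J. B i j * (G k i * G k j) / G k k + G' i j * B i j)"
      by (subst decomp) (simp add: algebra_simps)
    also have "\<dots> = (\<Sum>i\<in>?J. \<Sum>j\<in>?J. B i j * (G k i * G k j)) / G k k
        + (\<Sum>i\<in>?J. \<Sum>j\<in>?J. G' i j * B i j)"
      by (simp only: sum.distrib sum_divide_distrib)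
    also have "(\<Sum>i\<in>?J. \<Sum>j\<in>?J. G' i j * B i j) = (\<Sum>i\<in>I. \<Sum>j\<in>I. G' i j * B i j)"
      using insert.hyps zero by simp
    finally show ?thesis .
  qed
  have Gkk: "G k k \<ge> 0"
  proof -
    define c where "c j = (if j = k then 1 else 0 :: real)" for j
    have "(\<Sum>j\<in>?J. G i j * (c i * c j)) = (\<Sum>j\<in>?J. if j = k then G i k * c i else 0)" for i
      by (intro sum.cong) (auto simp: c_def)
    then have "(\<Sum>i\<in>?J. \<Sum>j\<in>?J. G i j * (c i * c j)) = (\<Sum>i\<in>?J. G i k * c i)"
      using insert.hyps(1) by simp
    also have "\<dots> = (\<Sum>i\<in>?J. if i = k then G k k else 0)"
      by (intro sum.cong) (auto simp: c_def)
    also have "\<dots> = G k k" using insert.hyps(1) by simp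
    finally show ?thesis using insert.prems(2)[of c] by simp
  qed
  have "0 \<le> (\<Sum>i\<in>I. \<Sum>j\<in>I. G' i j * A i j)"
  proof (rule insert.IH)
    show "G' i j = G' j i" if "i \<in> I" "j \<in> I" for i j
      using sym that by (simp add: G'_def)
    show "0 \<le> (\<Sum>i\<in>I. \<Sum>j\<in>I. G' i j * (c i * c j))" for c
    proof -
      \<comment> \<open>The entry at \<open>k\<close> makes \<open>c'\<close> orthogonal to the k-th
        unit vector with respect to \<open>G\<close>. The rank-one part then vanishes at
        \<open>c'\<close>, and the value of \<open>G'\<close> at \<open>c\<close> is the value of
        \<open>G\<close> at \<open>c'\<close>.\<close>
      define c' where "c' = c(k := - (\<Sum>j\<in>I. c j * G k j) / G k k)"
      have "(\<Sum>j\<in>I. c' j * G k j) = (\<Sum>j\<in>I. c j * G k j)"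
        using insert.hyps(2) by (intro sum.cong) (auto simp: c'_def)
      moreover have "(\<Sum>j\<in>I. c j * G k j) = 0" if "G k k = 0"
        using row[OF _ that] by simp
      ultimately have c'0: "(\<Sum>i\<in>?J. c' i * G k i) = 0"
        using insert.hyps by (auto simp: c'_def)
      have "0 \<le> (\<Sum>i\<in>?J. \<Sum>j\<in>?J. G i j * (c' i * c' j))" by (rule insert.prems(2))
      also have "\<dots> = (\<Sum>i\<in>?J. \<Sum>j\<in>?J. (c' i * c' j) * (G k i * G k j)) / G k k
          + (\<Sum>i\<in>I. \<Sum>j\<in>I. G' i j * (c' i * c' j))" by (rule red)
      also have "(\<Sum>i\<in>?J. \<Sum>j\<in>?J. (c' i * c' j) * (G k i * G k j)) = (\<Sum>i\<in>?J. c' i * G k i) * (\<Sum>i\<in>?J. c' i * G k i)"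
        unfolding sum_product by (simp only: ac_simps)
      also have "(\<Sum>i\<in>I. \<Sum>j\<in>I. G' i j * (c' i * c' j)) = (\<Sum>i\<in>I. \<Sum>j\<in>I. G' i j * (c i * c j))"
        using insert.hyps(2) by (intro sum.cong) (auto simp: c'_def)
      finally show ?thesis using c'0 by simp
    qed
    show "0 \<le> (\<Sum>i\<in>I. \<Sum>j\<in>I. A i j * (c i * c j))" for c
    proof -
      define c' where "c' = c(k := 0)"
      have "(\<Sum>i\<in>?J. \<Sum>j\<in>?J. A i j * (c' i * c' j)) = (\<Sum>i\<in>I. \<Sum>j\<in>I. A i j * (c' i * c' j))"
        using insert.hyps by (simp add: c'_def)
      also have "\<dots> = (\<Sum>i\<in>I. \<Sum>j\<in>I. A i j * (c i * c j))"
        using insert.hyps(2) by (intro sum.cong) (auto simp: c'_def)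
      finally show ?thesis using insert.prems(3)[of c'] by simp
    qed
  qed
  moreover have "0 \<le> (\<Sum>i\<in>?J. \<Sum>j\<in>?J. A i j * (G k i * G k j)) / G k k"
    using insert.prems(3)[of "G k"] Gkk by simp
  ultimately show ?case unfolding red by simp
qed simp

lemma sum_swap_outer_inner:
  "(\<Sum>i\<in>I. \<Sum>j\<in>J. \<Sum>m\<in>K. f i j m) = (\<Sum>m\<in>K. \<Sum>j\<in>J. \<Sum>i\<in>I. f i j m)"
proof -
  have "(\<Sum>i\<in>I. \<Sum>j\<in>J. \<Sum>m\<in>K. f i j m) = (\<Sum>i\<in>I. \<Sum>m\<in>K. \<Sum>j\<in>J. f i j m)"
    by (intro sum.cong sum.swap refl)
  also have "\<dots> = (\<Sum>m\<in>K. \<Sum>i\<in>I. \<Sum>j\<in>J. f i j m)" by (rule sum.swap)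
  also have "\<dots> = (\<Sum>m\<in>K. \<Sum>j\<in>J. \<Sum>i\<in>I. f i j m)" by (intro sum.cong sum.swap refl)
  finally show ?thesis .
qed

lemma sum_swap_pairs:
  "(\<Sum>i\<in>I. \<Sum>j\<in>J. \<Sum>m\<in>K. \<Sum>n\<in>L. f i j m n) = (\<Sum>m\<in>K. \<Sum>n\<in>L. \<Sum>i\<in>I. \<Sum>j\<in>J. f i j m n)"
proof -
  have "(\<Sum>i\<in>I. \<Sum>j\<in>J. \<Sum>m\<in>K. \<Sum>n\<in>L. f i j m n) = (\<Sum>i\<in>I. \<Sum>m\<in>K. \<Sum>n\<in>L. \<Sum>j\<in>J. f i j m n)"
    by (intro sum.cong refl) (subst sum.swap, intro sum.cong refl sum.swap)
  also have "\<dots> = (\<Sum>m\<in>K. \<Sum>n\<in>L. \<Sum>i\<in>I. \<Sum>j\<in>J. f i j m n)"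
    by (subst sum.swap) (intro sum.cong refl sum.swap)
  finally show ?thesis .
qed

lemma partial_deriv_const: "partial_deriv i (\<lambda>y. c) x = 0"
  by (simp add: partial_deriv_def)

context
  fixes \<Omega> :: "(real^'d::finite) set"
  assumes op: "open \<Omega>"
begin

lemma smooth_on_partial_deriv: "smooth_on \<Omega> f \<Longrightarrow> smooth_on \<Omega> (partial_deriv i f)"
  unfolding partial_deriv_def by (rule smooth_on_frechet_derivative[OF op])

lemma partial_deriv_commute:
  "smooth_on \<Omega> f \<Longrightarrow> x \<in> \<Omega> \<Longrightarrow> partial_deriv i (partial_deriv j f) x = partial_deriv j (partial_deriv i f) x"
  unfolding partial_deriv_def by (rule frechet_derivative_commute[OF op])

lemma partial_deriv_cong:
  assumes "smooth_on \<Omega> f" "x \<in> \<Omega>" "\<And>y. y \<in> \<Omega> \<Longrightarrow> f y = g y"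
  shows "partial_deriv i f x = partial_deriv i g x"
proof -
  have "(f has_derivative frechet_derivative f (at x)) (at x)"
    using smooth_on_imp_has_derivative[OF op assms(1,2)] .
  from has_derivative_transform_within_open[OF this op assms(2,3)]
  show ?thesis by (simp add: partial_deriv_def frechet_derivative_at[symmetric])
qed

lemma partial_deriv_add:
  assumes "smooth_on \<Omega> f" "smooth_on \<Omega> g" "x \<in> \<Omega>"
  shows "partial_deriv i (\<lambda>y. f y + g y) x = partial_deriv i f x + partial_deriv i g x"
  using has_derivative_add[OF smooth_on_imp_has_derivative[OF op assms(1,3)] smooth_on_imp_has_derivative[OF op assms(2,3)]]
  by (simp add: partial_deriv_def frechet_derivative_at[symmetric])

lemma partial_deriv_diff:
  assumes "smooth_on \<Omega> f" "smooth_on \<Omega> g" "x \<in> \<Omega>"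
  shows "partial_deriv i (\<lambda>y. f y - g y) x = partial_deriv i f x - partial_deriv i g x"
  using has_derivative_diff[OF smooth_on_imp_has_derivative[OF op assms(1,3)] smooth_on_imp_has_derivative[OF op assms(2,3)]]
  by (simp add: partial_deriv_def frechet_derivative_at[symmetric])

lemma partial_deriv_mult:
  assumes "smooth_on \<Omega> f" "smooth_on \<Omega> g" "x \<in> \<Omega>"
  shows "partial_deriv i (\<lambda>y. f y * g y) x = partial_deriv i f x * g x + f x * partial_deriv i g x"
  using has_derivative_mult[OF smooth_on_imp_has_derivative[OF op assms(1,3)] smooth_on_imp_has_derivative[OF op assms(2,3)]]
  by (simp add: partial_deriv_def frechet_derivative_at[symmetric])

lemma partial_deriv_cmult:
  assumes "smooth_on \<Omega> f" "x \<in> \<Omega>"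
  shows "partial_deriv i (\<lambda>y. c * f y) x = c * partial_deriv i f x"
  using partial_deriv_mult[OF smooth_on_const assms] by (simp add: partial_deriv_const)

lemma partial_deriv_sum:
  assumes "\<And>j. j \<in> J \<Longrightarrow> smooth_on \<Omega> (f j)" "x \<in> \<Omega>"
  shows "partial_deriv i (\<lambda>y. \<Sum>j\<in>J. f j y) x = (\<Sum>j\<in>J. partial_deriv i (f j) x)"
  using assms
  by (induction J rule: infinite_finite_induct)
    (simp_all add: partial_deriv_const partial_deriv_add smooth_on_sum)

end

section \<open>Bochner's formula\<close>

text \<open>A torsion-free connection \<open>\<Gamma> k i j = \<Gamma>\<^sup>k\<^sub>i\<^sub>j\<close> that is compatible with the inverse metric
  \<open>G i j = g\<^sup>i\<^sup>j\<close>. In tensors such as \<open>hess f a i\<close> only the last index is treated as a covector index by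
  \<open>cov\<close>; the others are labels.\<close>

locale levi_civita =
  fixes \<Omega> :: "(real^'d::finite) set"
    and G :: "'d \<Rightarrow> 'd \<Rightarrow> real^'d \<Rightarrow> real"
    and \<Gamma> :: "'d \<Rightarrow> 'd \<Rightarrow> 'd \<Rightarrow> real^'d \<Rightarrow> real"
  assumes op: "open \<Omega>"
    and smooth_G: "smooth_on \<Omega> (G i j)"
    and smooth_\<Gamma>: "smooth_on \<Omega> (\<Gamma> k i j)"
    and G_sym: "x \<in> \<Omega> \<Longrightarrow> G i j x = G j i x"
    and torsion_free: "x \<in> \<Omega> \<Longrightarrow> \<Gamma> k i j x = \<Gamma> k j i x"
    and partial_deriv_G: "x \<in> \<Omega> \<Longrightarrow>
      partial_deriv a (G i j) x = - (\<Sum>m\<in>UNIV. \<Gamma> i a m x * G m j x) - (\<Sum>m\<in>UNIV. \<Gamma> j a m x * G i m x)"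
begin

definition ip :: "('d \<Rightarrow> real^'d \<Rightarrow> real) \<Rightarrow> ('d \<Rightarrow> real^'d \<Rightarrow> real) \<Rightarrow> real^'d \<Rightarrow> real" where
  "ip v w x = (\<Sum>i\<in>UNIV. \<Sum>j\<in>UNIV. G i j x * v i x * w j x)"

definition cov :: "'d \<Rightarrow> ('d \<Rightarrow> real^'d \<Rightarrow> real) \<Rightarrow> 'd \<Rightarrow> real^'d \<Rightarrow> real" where
  "cov a v i x = partial_deriv a (v i) x - (\<Sum>m\<in>UNIV. \<Gamma> m a i x * v m x)"

text \<open>The index order follows \<open>curvature_coeff\<close>, so that \<open>ricci\<close>
  unfolds to a trace of \<open>curv\<close>.\<close>

definition curv :: "'d \<Rightarrow> 'd \<Rightarrow> 'd \<Rightarrow> 'd \<Rightarrow> real^'d \<Rightarrow> real" where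
  "curv l k i j x =
     partial_deriv i (\<Gamma> l j k) x - partial_deriv j (\<Gamma> l i k) x
     + (\<Sum>m\<in>UNIV. \<Gamma> l i m x * \<Gamma> m j k x - \<Gamma> l j m x * \<Gamma> m i k x)"

lemmas smooth_intros = smooth_G smooth_\<Gamma> smooth_on_sum smooth_on_mult smooth_on_add smooth_on_diff
  smooth_on_const smooth_on_partial_deriv[OF op]

lemma smooth_ip: "(\<And>i. smooth_on \<Omega> (v i)) \<Longrightarrow> (\<And>i. smooth_on \<Omega> (w i)) \<Longrightarrow> smooth_on \<Omega> (ip v w)"
  unfolding ip_def[abs_def] by (intro smooth_intros)

lemma smooth_cov: "(\<And>i. smooth_on \<Omega> (v i)) \<Longrightarrow> smooth_on \<Omega> (cov a v i)"
  unfolding cov_def[abs_def] by (intro smooth_intros)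

lemma ip_commute: "x \<in> \<Omega> \<Longrightarrow> ip v w x = ip w v x"
  unfolding ip_def by (subst sum.swap) (simp add: G_sym mult_ac)

lemma ip_diff_left: "ip (\<lambda>i y. v i y - w i y) z x = ip v z x - ip w z x"
  by (simp add: ip_def algebra_simps sum_subtractf)

lemma ip_diff_right: "ip z (\<lambda>i y. v i y - w i y) x = ip z v x - ip z w x"
  by (simp add: ip_def algebra_simps sum_subtractf)

text \<open>Metric compatibility as a product rule: after renaming summation indices, the two
  Christoffel sums in the derivative of \<open>G\<close> become the corrections in the two covariant
  derivatives.\<close>

lemma partial_deriv_ip:
  assumes v: "\<And>i. smooth_on \<Omega> (v i)" and w: "\<And>i. smooth_on \<Omega> (w i)" and x: "x \<in> \<Omega>"
  shows "partial_deriv a (ip v w) x = ip (cov a v) w x + ip v (cov a w) x"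
proof -
  have 1: "partial_deriv a (ip v w) x = (\<Sum>i\<in>UNIV. \<Sum>j\<in>UNIV.
      (partial_deriv a (G i j) x * v i x + G i j x * partial_deriv a (v i) x) * w j x
      + G i j x * v i x * partial_deriv a (w j) x)"
    unfolding ip_def[abs_def] using v w x
    by (simp add: partial_deriv_sum[OF op] partial_deriv_mult[OF op] smooth_intros)
  have 2: "(\<Sum>i\<in>UNIV. \<Sum>j\<in>UNIV. \<Sum>m\<in>UNIV. \<Gamma> i a m x * G m j x * v i x * w j x) =
      (\<Sum>i\<in>UNIV. \<Sum>j\<in>UNIV. \<Sum>m\<in>UNIV. G i j x * (\<Gamma> m a i x * v m x) * w j x)"
    by (subst sum_swap_outer_inner) (simp add: mult_ac)
  have 3: "(\<Sum>i\<in>UNIV. \<Sum>j\<in>UNIV. \<Sum>m\<in>UNIV. \<Gamma> j a m x * G i m x * v i x * w j x) =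
      (\<Sum>i\<in>UNIV. \<Sum>j\<in>UNIV. \<Sum>m\<in>UNIV. G i j x * v i x * (\<Gamma> m a j x * w m x))"
  proof -
    have "(\<Sum>j\<in>UNIV. \<Sum>m\<in>UNIV. \<Gamma> j a m x * G i m x * v i x * w j x) =
       (\<Sum>j\<in>UNIV. \<Sum>m\<in>UNIV. G i j x * v i x * (\<Gamma> m a j x * w m x))" for i
      by (subst sum.swap) (simp add: mult_ac)
    then show ?thesis by simp
  qed
  show ?thesis
    unfolding 1 ip_def cov_def partial_deriv_G[OF x]
    using 2 3
    by (simp add: algebra_simps sum.distrib sum_subtractf sum_distrib_left sum_distrib_right)
qed

text \<open>The Ricci identity for covectors. The directions are coordinate fields, which commute,
  so no further first-order term appears.\<close>

lemma cov_commutator: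
  assumes v: "\<And>i. smooth_on \<Omega> (v i)" and x: "x \<in> \<Omega>"
  shows "cov b (cov a v) i x - cov a (cov b v) i x = - (\<Sum>m\<in>UNIV. curv m i b a x * v m x)"
proof -
  \<comment> \<open>Exchanging a and b swaps the third and fourth terms, so they cancel in the
    commutator; the second and the fifth assemble to \<open>curv\<close>.\<close>
  have *: "cov b (cov a v) i x = partial_deriv b (partial_deriv a (v i)) x
     - (\<Sum>m\<in>UNIV. partial_deriv b (\<Gamma> m a i) x * v m x)
     - (\<Sum>m\<in>UNIV. \<Gamma> m a i x * partial_deriv b (v m) x)
     - (\<Sum>n\<in>UNIV. \<Gamma> n b i x * partial_deriv a (v n) x)
     + (\<Sum>m\<in>UNIV. (\<Sum>n\<in>UNIV. \<Gamma> m a n x * \<Gamma> n b i x) * v m x)" for a b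
  proof -
    have "partial_deriv b (cov a v i) x = partial_deriv b (partial_deriv a (v i)) x
        - (\<Sum>m\<in>UNIV. partial_deriv b (\<Gamma> m a i) x * v m x + \<Gamma> m a i x * partial_deriv b (v m) x)"
      unfolding cov_def[abs_def] using v x
      by (simp add: partial_deriv_sum[OF op] partial_deriv_mult[OF op] partial_deriv_diff[OF op] smooth_intros)
    moreover have "(\<Sum>n\<in>UNIV. \<Gamma> n b i x * cov a v n x) = (\<Sum>n\<in>UNIV. \<Gamma> n b i x * partial_deriv a (v n) x)
       - (\<Sum>n\<in>UNIV. \<Sum>m\<in>UNIV. \<Gamma> m a n x * \<Gamma> n b i x * v m x)"
      by (simp add: cov_def algebra_simps sum_subtractf sum_distrib_left)
    moreover have "(\<Sum>n\<in>UNIV. \<Sum>m\<in>UNIV. \<Gamma> m a n x * \<Gamma> n b i x * v m x) =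
        (\<Sum>m\<in>UNIV. (\<Sum>n\<in>UNIV. \<Gamma> m a n x * \<Gamma> n b i x) * v m x)"
      by (subst sum.swap) (simp add: sum_distrib_right)
    ultimately show ?thesis
      unfolding cov_def[of b "cov a v"] by (simp add: sum.distrib)
  qed
  show ?thesis
    unfolding * curv_def partial_deriv_commute[OF op v x, of b a]
    by (simp add: algebra_simps sum.distrib sum_subtractf)
qed

text \<open>The mixed partial derivatives of the function \<open>G i j\<close>, seen as an inner
  product of two coordinate covectors, commute. In the product rule for them the cross terms are
  symmetric in a and b, so only the two commutators survive, and their sum is zero.\<close>

lemma curv_antisym:
  assumes x: "x \<in> \<Omega>"
  shows "(\<Sum>k\<in>UNIV. G k j x * curv i k b a x) = - (\<Sum>k\<in>UNIV. G i k x * curv j k b a x)"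
proof -
  \<comment> \<open>The i-th coordinate covector field, with constant components; pairing with it
    extracts a row of \<open>G\<close>.\<close>
  define e :: "'d \<Rightarrow> 'd \<Rightarrow> real^'d \<Rightarrow> real" where "e i k y = (if k = i then 1 else 0)" for i k y
  have sm: "smooth_on \<Omega> (e i k)" for i k
    unfolding e_def[abs_def] by (rule smooth_on_const)
  note sc = smooth_cov[of "e i", OF sm] smooth_cov[of "e j", OF sm]
  have second: "partial_deriv b (partial_deriv a (ip (e i) (e j))) x =
      ip (cov b (cov a (e i))) (e j) x + ip (cov a (e i)) (cov b (e j)) x
      + ip (cov b (e i)) (cov a (e j)) x + ip (e i) (cov b (cov a (e j))) x" for a b
  proof -
    have "partial_deriv b (partial_deriv a (ip (e i) (e j))) x
        = partial_deriv b (\<lambda>y. ip (cov a (e i)) (e j) y + ip (e i) (cov a (e j)) y) x"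
      by (rule partial_deriv_cong[OF op])
        (simp_all add: partial_deriv_ip sm x smooth_intros smooth_ip)
    also have "\<dots> = partial_deriv b (ip (cov a (e i)) (e j)) x + partial_deriv b (ip (e i) (cov a (e j))) x"
      by (intro partial_deriv_add[OF op] smooth_ip sm sc x)
    finally show ?thesis by (simp add: partial_deriv_ip sm sc x)
  qed
  have "partial_deriv b (partial_deriv a (ip (e i) (e j))) x = partial_deriv a (partial_deriv b (ip (e i) (e j))) x"
    by (intro partial_deriv_commute[OF op] smooth_ip sm x)
  then have "ip (\<lambda>k y. cov b (cov a (e i)) k y - cov a (cov b (e i)) k y) (e j) x
      + ip (e i) (\<lambda>k y. cov b (cov a (e j)) k y - cov a (cov b (e j)) k y) x = 0"
    unfolding second ip_diff_left ip_diff_right by simp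
  moreover have K: "cov b (cov a (e i)) k x - cov a (cov b (e i)) k x = - curv i k b a x" for i k
    using cov_commutator[of "e i", OF sm x] by (simp add: e_def if_distrib cong: if_cong)
  moreover have ip_e: "ip v (e l) x = (\<Sum>k\<in>UNIV. G k l x * v k x)" for v l
    by (simp add: ip_def e_def if_distrib[of "\<lambda>z. _ * z"] cong: if_cong)
  ultimately have "(\<Sum>k\<in>UNIV. G k j x * - curv i k b a x) + (\<Sum>k\<in>UNIV. G k i x * - curv j k b a x) = 0"
    unfolding ip_commute[OF x, of "e i"] ip_e K by blast
  then show ?thesis
    by (simp add: sum_negf G_sym[OF x, of _ i] eq_neg_iff_add_eq_0 neg_eq_iff_add_eq_0 add.commute)
qed

section \<open>The Hessian, its covariant derivative and the Laplacian\<close>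

definition lap :: "(real^'d \<Rightarrow> real) \<Rightarrow> real^'d \<Rightarrow> real" where
  "lap f x = (\<Sum>i\<in>UNIV. \<Sum>j\<in>UNIV. G i j x *
     (partial_deriv i (partial_deriv j f) x - (\<Sum>k\<in>UNIV. \<Gamma> k i j x * partial_deriv k f x)))"

definition differential :: "(real^'d \<Rightarrow> real) \<Rightarrow> 'd \<Rightarrow> real^'d \<Rightarrow> real" where
  "differential f i = partial_deriv i f"

definition grad :: "(real^'d \<Rightarrow> real) \<Rightarrow> 'd \<Rightarrow> real^'d \<Rightarrow> real" where
  "grad f i x = (\<Sum>j\<in>UNIV. G i j x * partial_deriv j f x)"

definition hess :: "(real^'d \<Rightarrow> real) \<Rightarrow> 'd \<Rightarrow> 'd \<Rightarrow> real^'d \<Rightarrow> real" where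
  "hess f a = cov a (differential f)"

text \<open>The third covariant derivative of \<open>f\<close>, in direction \<open>b\<close>. As
  \<open>cov\<close> corrects only for the index \<open>i\<close>, the correction for the label
  \<open>a\<close> is subtracted separately.\<close>

definition hess_deriv :: "(real^'d \<Rightarrow> real) \<Rightarrow> 'd \<Rightarrow> 'd \<Rightarrow> 'd \<Rightarrow> real^'d \<Rightarrow> real" where
  "hess_deriv f b a i x = cov b (hess f a) i x - (\<Sum>c\<in>UNIV. \<Gamma> c b a x * hess f c i x)"

lemma smooth_differential: "smooth_on \<Omega> f \<Longrightarrow> smooth_on \<Omega> (differential f i)"
  unfolding differential_def by (rule smooth_intros)

lemma smooth_hess: "smooth_on \<Omega> f \<Longrightarrow> smooth_on \<Omega> (hess f a i)"
  unfolding hess_def by (intro smooth_cov smooth_differential)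

lemma lap_hess: "lap f x = (\<Sum>i\<in>UNIV. \<Sum>j\<in>UNIV. G i j x * hess f i j x)"
  by (simp add: lap_def hess_def cov_def differential_def)

lemma hess_commute:
  assumes "smooth_on \<Omega> f" "x \<in> \<Omega>"
  shows "hess f a i x = hess f i a x"
  using partial_deriv_commute[OF op assms, of a i] torsion_free[OF assms(2), of _ a i]
  by (simp add: hess_def cov_def differential_def)

lemma hess_deriv_sym:
  assumes "smooth_on \<Omega> f" "x \<in> \<Omega>"
  shows "hess_deriv f b a i x = hess_deriv f b i a x"
proof -
  have "partial_deriv b (hess f a i) x = partial_deriv b (hess f i a) x"
    using assms by (intro partial_deriv_cong[OF op] smooth_hess hess_commute)
  moreover have "(\<Sum>m\<in>UNIV. \<Gamma> m b i x * hess f a m x) = (\<Sum>m\<in>UNIV. \<Gamma> m b i x * hess f m a x)" for a i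
    using hess_commute[OF assms] by simp
  ultimately show ?thesis
    unfolding hess_deriv_def cov_def by simp
qed

text \<open>The separate correction for the label is symmetric in b and i because there is no
  torsion, so it drops out and the commutator of \<open>cov\<close> remains.\<close>

lemma hess_deriv_commutator:
  assumes "smooth_on \<Omega> f" "x \<in> \<Omega>"
  shows "hess_deriv f b i a x - hess_deriv f i b a x = - (\<Sum>m\<in>UNIV. curv m a b i x * partial_deriv m f x)"
  using cov_commutator[of "differential f" x b i a, OF smooth_differential[OF assms(1)] assms(2)] torsion_free[OF assms(2), of _ b i]
  by (simp add: hess_deriv_def hess_def differential_def)

text \<open>The inverse metric is parallel, so the trace can be taken after the covariant
  differentiation; the index renaming is that of \<open>partial_deriv_ip\<close>.\<close>

lemma partial_deriv_lap:
  assumes f: "smooth_on \<Omega> f" and x: "x \<in> \<Omega>"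
  shows "partial_deriv k (lap f) x = (\<Sum>a\<in>UNIV. \<Sum>b\<in>UNIV. G a b x * hess_deriv f k a b x)"
proof -
  have 1: "partial_deriv k (lap f) x = (\<Sum>i\<in>UNIV. \<Sum>j\<in>UNIV.
      partial_deriv k (G i j) x * hess f i j x + G i j x * partial_deriv k (hess f i j) x)"
    unfolding lap_hess[abs_def] using f x
    by (simp add: partial_deriv_sum[OF op] partial_deriv_mult[OF op] smooth_intros smooth_hess)
  have 2: "(\<Sum>i\<in>UNIV. \<Sum>j\<in>UNIV. \<Sum>m\<in>UNIV. \<Gamma> i k m x * G m j x * hess f i j x) =
      (\<Sum>i\<in>UNIV. \<Sum>j\<in>UNIV. \<Sum>m\<in>UNIV. G i j x * (\<Gamma> m k i x * hess f m j x))"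
    by (subst sum_swap_outer_inner) (simp add: mult_ac)
  have 3: "(\<Sum>i\<in>UNIV. \<Sum>j\<in>UNIV. \<Sum>m\<in>UNIV. \<Gamma> j k m x * G i m x * hess f i j x) =
      (\<Sum>i\<in>UNIV. \<Sum>j\<in>UNIV. \<Sum>m\<in>UNIV. G i j x * (\<Gamma> m k j x * hess f i m x))"
  proof -
    have "(\<Sum>j\<in>UNIV. \<Sum>m\<in>UNIV. \<Gamma> j k m x * G i m x * hess f i j x) =
       (\<Sum>j\<in>UNIV. \<Sum>m\<in>UNIV. G i j x * (\<Gamma> m k j x * hess f i m x))" for i
      by (subst sum.swap) (simp add: mult_ac)
    then show ?thesis by simp
  qed
  show ?thesis
    unfolding 1 hess_deriv_def cov_def partial_deriv_G[OF x]
    using 2 3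
    by (simp add: algebra_simps sum.distrib sum_subtractf sum_distrib_left sum_distrib_right)
qed

lemma ip_differential_grad: "ip v (differential f) x = (\<Sum>i\<in>UNIV. grad f i x * v i x)"
  by (simp add: ip_def grad_def differential_def sum_distrib_left sum_distrib_right mult_ac)

text \<open>The third derivatives of \<open>f\<close> on both sides differ by a commutator, which the
  antisymmetry of the curvature turns into the Ricci term.\<close>

lemma bochner:
  assumes f: "smooth_on \<Omega> f" and x: "x \<in> \<Omega>"
  shows "lap (ip (differential f) (differential f)) x / 2 =
     (\<Sum>a\<in>UNIV. \<Sum>b\<in>UNIV. G a b x * ip (hess f a) (hess f b) x)
     + (\<Sum>k\<in>UNIV. grad f k x * partial_deriv k (lap f) x)
     + (\<Sum>j\<in>UNIV. \<Sum>k\<in>UNIV. (\<Sum>i\<in>UNIV. curv i k i j x) * grad f j x * grad f k x)"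
proof -
  let ?N = "ip (differential f) (differential f)"
  have first: "partial_deriv a ?N y = 2 * ip (hess f a) (differential f) y" if "y \<in> \<Omega>" for a y
    using that by (simp add: partial_deriv_ip smooth_differential f ip_commute[of _ "differential f"] hess_def)
  have second: "partial_deriv b (partial_deriv a ?N) x =
      2 * (ip (cov b (hess f a)) (differential f) x + ip (hess f a) (hess f b) x)" for a b
  proof -
    have "partial_deriv b (partial_deriv a ?N) x = partial_deriv b (\<lambda>y. 2 * ip (hess f a) (differential f) y) x"
      by (rule partial_deriv_cong[OF op]) (simp_all add: first smooth_intros smooth_ip smooth_differential f x)
    also have "\<dots> = 2 * partial_deriv b (ip (hess f a) (differential f)) x"
      by (intro partial_deriv_cmult[OF op] smooth_ip smooth_hess smooth_differential f x)
    finally show ?thesis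
      by (simp add: partial_deriv_ip smooth_hess smooth_differential f x hess_def[of f b, symmetric])
  qed
  \<comment> \<open>The Christoffel term in the Laplacian of |df|^2 is precisely the correction for
    the label b that completes \<open>cov a (hess f b)\<close> to the third derivative.\<close>
  have lin: "ip (cov a (hess f b)) (differential f) x - (\<Sum>c\<in>UNIV. \<Gamma> c a b x * ip (hess f c) (differential f) x)
      = (\<Sum>k\<in>UNIV. grad f k x * hess_deriv f a b k x)" for a b
  proof -
    have "(\<Sum>c\<in>UNIV. \<Gamma> c a b x * (\<Sum>k\<in>UNIV. grad f k x * hess f c k x)) =
        (\<Sum>k\<in>UNIV. grad f k x * (\<Sum>c\<in>UNIV. \<Gamma> c a b x * hess f c k x))"
      by (simp add: sum_distrib_left) (subst sum.swap, simp add: mult_ac)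
    then show ?thesis
      unfolding ip_differential_grad hess_deriv_def by (simp add: algebra_simps sum_subtractf)
  qed
  \<comment> \<open>Moves k to the front: symmetry in the last two indices, the commutator in the
    first two, and symmetry once more.\<close>
  have T: "hess_deriv f a b k x = hess_deriv f k b a x - (\<Sum>m\<in>UNIV. curv m b a k x * partial_deriv m f x)" for a b k
    using hess_deriv_commutator[OF f x, of a k b] hess_deriv_sym[OF f x, of a b k] hess_deriv_sym[OF f x, of k b a]
    by simp
  \<comment> \<open>Antisymmetry trades the upper index m for a, which then occurs twice: this is
    the Ricci trace, and the inverse metric left over raises the index of df.\<close>
  have ric: "(\<Sum>a\<in>UNIV. \<Sum>b\<in>UNIV. G a b x * (\<Sum>m\<in>UNIV. curv m b a k x * partial_deriv m f x)) =
      - (\<Sum>l\<in>UNIV. (\<Sum>a\<in>UNIV. curv a l a k x) * grad f l x)" for k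
  proof -
    have "(\<Sum>b\<in>UNIV. G a b x * (\<Sum>m\<in>UNIV. curv m b a k x * partial_deriv m f x)) =
        - (\<Sum>b\<in>UNIV. curv a b a k x * grad f b x)" for a
    proof -
      have "(\<Sum>b\<in>UNIV. G a b x * (\<Sum>m\<in>UNIV. curv m b a k x * partial_deriv m f x)) =
         (\<Sum>m\<in>UNIV. (\<Sum>b\<in>UNIV. G b a x * curv m b a k x) * partial_deriv m f x)"
        unfolding sum_distrib_left sum_distrib_right G_sym[OF x, of a]
        by (subst sum.swap) (simp add: mult_ac)
      also have "(\<Sum>m\<in>UNIV. (\<Sum>b\<in>UNIV. G b a x * curv m b a k x) * partial_deriv m f x) =
          - (\<Sum>m\<in>UNIV. \<Sum>b\<in>UNIV. curv a b a k x * (G b m x * partial_deriv m f x))"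
        unfolding curv_antisym[OF x]
        by (simp add: sum_distrib_left sum_distrib_right sum_negf G_sym[OF x] mult_ac)
      also have "(\<Sum>m\<in>UNIV. \<Sum>b\<in>UNIV. curv a b a k x * (G b m x * partial_deriv m f x)) =
          (\<Sum>b\<in>UNIV. curv a b a k x * grad f b x)"
        unfolding grad_def sum_distrib_left by (rule sum.swap)
      finally show ?thesis .
    qed
    then have "(\<Sum>a\<in>UNIV. \<Sum>b\<in>UNIV. G a b x * (\<Sum>m\<in>UNIV. curv m b a k x * partial_deriv m f x)) =
        - (\<Sum>a\<in>UNIV. \<Sum>b\<in>UNIV. curv a b a k x * grad f b x)"
      by (simp add: sum_negf)
    also have "(\<Sum>a\<in>UNIV. \<Sum>b\<in>UNIV. curv a b a k x * grad f b x) =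
        (\<Sum>l\<in>UNIV. (\<Sum>a\<in>UNIV. curv a l a k x) * grad f l x)"
      unfolding sum_distrib_right by (rule sum.swap)
    finally show ?thesis .
  qed
  have third: "(\<Sum>a\<in>UNIV. \<Sum>b\<in>UNIV. G a b x * hess_deriv f a b k x) =
      partial_deriv k (lap f) x + (\<Sum>l\<in>UNIV. (\<Sum>a\<in>UNIV. curv a l a k x) * grad f l x)" for k
  proof -
    have "(\<Sum>a\<in>UNIV. \<Sum>b\<in>UNIV. G a b x * hess_deriv f k b a x) = partial_deriv k (lap f) x"
      unfolding partial_deriv_lap[OF f x] using G_sym[OF x] hess_deriv_sym[OF f x] by simp
    moreover have "(\<Sum>a\<in>UNIV. \<Sum>b\<in>UNIV. G a b x * hess_deriv f a b k x) =
        (\<Sum>a\<in>UNIV. \<Sum>b\<in>UNIV. G a b x *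
          (hess_deriv f k b a x - (\<Sum>m\<in>UNIV. curv m b a k x * partial_deriv m f x)))"
      by (intro sum.cong refl arg_cong2[where f = "(*)"] T)
    ultimately show ?thesis
      unfolding right_diff_distrib sum_subtractf ric by simp
  qed
  have "lap ?N x / 2 = (\<Sum>a\<in>UNIV. \<Sum>b\<in>UNIV. G a b x * (ip (hess f b) (hess f a) x +
      (\<Sum>k\<in>UNIV. grad f k x * hess_deriv f a b k x)))"
  proof -
    have "(\<Sum>c\<in>UNIV. \<Gamma> c a b x * (2 * ip (hess f c) (differential f) x)) = 2 * (\<Sum>c\<in>UNIV. \<Gamma> c a b x * ip (hess f c) (differential f) x)" for a b
      by (simp add: sum_distrib_left mult_ac)
    then show ?thesis
      unfolding lap_def second first[OF x] lin[symmetric] sum_divide_distrib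
      by (intro sum.cong refl) (simp add: field_simps)
  qed
  also have "\<dots> = (\<Sum>a\<in>UNIV. \<Sum>b\<in>UNIV. G a b x * ip (hess f a) (hess f b) x)
      + (\<Sum>a\<in>UNIV. \<Sum>b\<in>UNIV. \<Sum>k\<in>UNIV. grad f k x * (G a b x * hess_deriv f a b k x))"
    by (simp add: algebra_simps sum.distrib sum_distrib_left ip_commute[OF x])
  also have "(\<Sum>a\<in>UNIV. \<Sum>b\<in>UNIV. \<Sum>k\<in>UNIV. grad f k x * (G a b x * hess_deriv f a b k x)) =
      (\<Sum>k\<in>UNIV. grad f k x * (\<Sum>a\<in>UNIV. \<Sum>b\<in>UNIV. G a b x * hess_deriv f a b k x))"
    unfolding sum_distrib_left by (subst sum_swap_outer_inner) (intro sum.cong refl sum.swap)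
  finally show ?thesis
    unfolding third by (simp add: algebra_simps sum.distrib sum_distrib_left)
qed

lemma lap_linear:
  assumes f: "smooth_on \<Omega> f" and h: "smooth_on \<Omega> h" and x: "x \<in> \<Omega>"
  shows "lap (\<lambda>y. a * f y + h y) x = a * lap f x + lap h x"
proof -
  have first: "partial_deriv j (\<lambda>y. a * f y + h y) y = a * partial_deriv j f y + partial_deriv j h y"
    if "y \<in> \<Omega>" for j y
    using that f h by (simp add: partial_deriv_add[OF op] partial_deriv_cmult[OF op] smooth_intros)
  have "partial_deriv i (partial_deriv j (\<lambda>y. a * f y + h y)) x =
      partial_deriv i (\<lambda>y. a * partial_deriv j f y + partial_deriv j h y) x" for i j
    using first by (intro partial_deriv_cong[OF op _ x] smooth_intros f h)
  then have "partial_deriv i (partial_deriv j (\<lambda>y. a * f y + h y)) x =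
      a * partial_deriv i (partial_deriv j f) x + partial_deriv i (partial_deriv j h) x" for i j
    using x f h by (simp add: partial_deriv_add[OF op] partial_deriv_cmult[OF op] smooth_intros)
  then show ?thesis
    unfolding lap_def first[OF x]
    by (simp add: algebra_simps sum.distrib sum_subtractf sum_distrib_left)
qed

text \<open>|Hess f|^2 pairs the inverse metric with the Gram matrix of the rows of the Hessian, and
  a Gram matrix is semidefinite.\<close>

lemma hess_norm_nonneg:
  assumes psd: "\<And>a. 0 \<le> (\<Sum>i\<in>UNIV. \<Sum>j\<in>UNIV. G i j x * (a i * a j))" and x: "x \<in> \<Omega>"
  shows "0 \<le> (\<Sum>a\<in>UNIV. \<Sum>b\<in>UNIV. G a b x * ip (hess f a) (hess f b) x)"
proof (rule sum_mult_psd_nonneg)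
  fix c :: "'d \<Rightarrow> real"
  have "(\<Sum>a\<in>UNIV. \<Sum>b\<in>UNIV. ip (hess f a) (hess f b) x * (c a * c b)) =
      (\<Sum>a\<in>UNIV. \<Sum>b\<in>UNIV. \<Sum>i\<in>UNIV. \<Sum>j\<in>UNIV. G i j x * ((c a * hess f a i x) * (c b * hess f b j x)))"
    by (simp add: ip_def sum_distrib_left sum_distrib_right mult_ac)
  also have "\<dots> = (\<Sum>i\<in>UNIV. \<Sum>j\<in>UNIV. G i j x *
      ((\<Sum>a\<in>UNIV. c a * hess f a i x) * (\<Sum>b\<in>UNIV. c b * hess f b j x)))"
    unfolding sum_product unfolding sum_distrib_left by (rule sum_swap_pairs)
  finally show "0 \<le> (\<Sum>a\<in>UNIV. \<Sum>b\<in>UNIV. ip (hess f a) (hess f b) x * (c a * c b))"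
    using psd by simp
qed (use psd G_sym[OF x] in auto)

end

section \<open>The inverse metric and the Christoffel symbols\<close>

lemma
  fixes A :: "real^'n^'n"
  assumes "det A \<noteq> 0"
  shows matrix_inv_right: "A ** matrix_inv A = mat 1" and matrix_inv_left: "matrix_inv A ** A = mat 1"
proof -
  have "\<exists>B. A ** B = mat 1 \<and> B ** A = mat 1"
    using assms unfolding invertible_det_nz[symmetric] invertible_def .
  then have "A ** matrix_inv A = mat 1 \<and> matrix_inv A ** A = mat 1"
    unfolding matrix_inv_def by (rule someI_ex)
  then show "A ** matrix_inv A = mat 1" "matrix_inv A ** A = mat 1" by auto
qed

lemma
  fixes A :: "real^'n^'n"
  assumes "det A \<noteq> 0"
  shows matrix_inv_right_nth: "(\<Sum>k\<in>UNIV. A $ i $ k * matrix_inv A $ k $ j) = (if i = j then 1 else 0)"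
    and matrix_inv_left_nth: "(\<Sum>k\<in>UNIV. matrix_inv A $ i $ k * A $ k $ j) = (if i = j then 1 else 0)"
  using arg_cong[OF matrix_inv_right[OF assms], of "\<lambda>M. M $ i $ j"]
    arg_cong[OF matrix_inv_left[OF assms], of "\<lambda>M. M $ i $ j"]
  by (simp_all add: matrix_matrix_mult_def mat_def)

text \<open>As quotients of polynomials in the entries, the entries of the inverse inherit
  smoothness and continuity.\<close>

lemma matrix_inv_cramer:
  fixes A :: "real^'n^'n"
  assumes "det A \<noteq> 0"
  shows "matrix_inv A $ k $ l = det (\<chi> i j. if j = k then (if i = l then 1 else 0) else A $ i $ j) / det A"
proof -
  have "A *v (matrix_inv A *v axis l 1) = axis l 1"
    by (simp add: matrix_vector_mul_assoc matrix_inv_right[OF assms])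
  then have "matrix_inv A *v axis l 1 = (\<chi> k. det (\<chi> i j. if j = k then axis l 1 $ i else A $ i $ j) / det A)"
    by (simp add: cramer[OF assms])
  then have "(matrix_inv A *v axis l 1) $ k = det (\<chi> i j. if j = k then axis l 1 $ i else A $ i $ j) / det A"
    by simp
  also have "(matrix_inv A *v axis l 1) $ k = matrix_inv A $ k $ l"
    by (simp add: matrix_vector_mult_def axis_def if_distrib cong: if_cong)
  also have "(\<chi> i j. if j = k then axis l 1 $ i else A $ i $ j) = (\<chi> i j. if j = k then (if i = l then 1 else 0) else A $ i $ j)"
    by (simp add: axis_def vec_eq_iff)
  finally show ?thesis .
qed

lemma matrix_inv_symmetric:
  fixes A :: "real^'n^'n"
  assumes "det A \<noteq> 0" "\<And>i j. A $ i $ j = A $ j $ i"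
  shows "matrix_inv A $ i $ j = matrix_inv A $ j $ i"
proof -
  have tr: "transpose A = A" using assms(2) by (simp add: transpose_def vec_eq_iff)
  have "transpose (matrix_inv A) ** A = mat 1"
    using arg_cong[OF matrix_inv_right[OF assms(1)], of transpose]
    by (simp add: matrix_transpose_mul tr transpose_mat)
  then have "transpose (matrix_inv A) ** (A ** matrix_inv A) = matrix_inv A"
    by (simp add: matrix_mul_assoc)
  then have "transpose (matrix_inv A) = matrix_inv A"
    by (simp add: matrix_inv_right[OF assms(1)])
  from arg_cong[OF this, of "\<lambda>M. M $ j $ i"] show ?thesis by (simp add: transpose_def)
qed

lemma smooth_on_det:
  fixes f :: "'a::euclidean_space \<Rightarrow> real^'n^'n"
  assumes "\<And>i j. smooth_on S (\<lambda>x. f x $ i $ j)"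
  shows "smooth_on S (\<lambda>x. det (f x))"
  unfolding det_def by (intro smooth_on_sum smooth_on_mult smooth_on_prod smooth_on_const assms)

lemma smooth_on_matrix_inv:
  fixes f :: "'a::euclidean_space \<Rightarrow> real^'n^'n"
  assumes "\<And>i j. smooth_on S (\<lambda>x. f x $ i $ j)" "\<And>x. x \<in> S \<Longrightarrow> det (f x) \<noteq> 0"
  shows "smooth_on S (\<lambda>x. matrix_inv (f x) $ k $ l)"
proof (rule smooth_on_cong)
  show "smooth_on S (\<lambda>x. det (\<chi> i j. if j = k then (if i = l then 1 else 0) else f x $ i $ j) * inverse (det (f x)))"
  proof (intro smooth_on_mult smooth_on_inverse smooth_on_det assms)
    show "smooth_on S (\<lambda>x. (\<chi> i j. if j = k then (if i = l then 1 else 0) else f x $ i $ j) $ i $ j)" for i j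
      by (cases "j = k") (simp_all add: assms smooth_on_const)
  qed
qed (simp add: matrix_inv_cramer assms(2) divide_inverse)

lemma continuous_on_matrix_inv:
  fixes f :: "'a::topological_space \<Rightarrow> real^'n^'n"
  assumes "\<And>i j. continuous_on S (\<lambda>x. f x $ i $ j)" "\<And>x. x \<in> S \<Longrightarrow> det (f x) \<noteq> 0"
  shows "continuous_on S (\<lambda>x. matrix_inv (f x) $ k $ l)"
proof -
  have det: "continuous_on S (\<lambda>x. det (h x))"
    if "\<And>i j. continuous_on S (\<lambda>x. h x $ i $ j)" for h :: "'a \<Rightarrow> real^'n^'n"
    unfolding det_def by (intro continuous_intros that)
  have "continuous_on S (\<lambda>x. det (\<chi> i j. if j = k then (if i = l then 1 else 0) else f x $ i $ j) / det (f x))"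
  proof (intro continuous_on_divide det assms ballI)
    show "continuous_on S (\<lambda>x. (\<chi> i j. if j = k then (if i = l then 1 else 0) else f x $ i $ j) $ i $ j)" for i j
      by (cases "j = k") (simp_all add: assms)
  qed
  then show ?thesis
    by (rule continuous_on_eq) (simp add: matrix_inv_cramer assms(2))
qed

text \<open>The resolvent identity, which turns a difference quotient of the inverse into one of the
  matrix itself.\<close>

lemma matrix_inv_diff_nth:
  fixes A B :: "real^'n^'n"
  assumes "det A \<noteq> 0" "det B \<noteq> 0"
  shows "matrix_inv A $ i $ j - matrix_inv B $ i $ j =
    - (\<Sum>m\<in>UNIV. \<Sum>k\<in>UNIV. matrix_inv A $ i $ m * (A $ m $ k - B $ m $ k) * matrix_inv B $ k $ j)"
proof -
  have "matrix_inv A ** (A - B) ** matrix_inv B = matrix_inv B - matrix_inv A"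
  proof -
    have "matrix_inv A ** (A - B) = matrix_inv A ** A - matrix_inv A ** B"
      by (simp add: matrix_matrix_mult_def vec_eq_iff right_diff_distrib sum_subtractf)
    moreover have "(mat 1 - matrix_inv A ** B) ** matrix_inv B = mat 1 ** matrix_inv B - (matrix_inv A ** B) ** matrix_inv B"
      by (simp only: matrix_matrix_mult_def vec_eq_iff left_diff_distrib sum_subtractf vec_lambda_beta vector_minus_component) simp
    ultimately show ?thesis
      using matrix_inv_left[OF assms(1)] matrix_inv_right[OF assms(2)]
      by (simp add: matrix_mul_assoc[symmetric])
  qed
  from arg_cong[OF this, of "\<lambda>M. M $ i $ j"]
  have "(\<Sum>k\<in>UNIV. \<Sum>m\<in>UNIV. matrix_inv A $ i $ m * (A $ m $ k - B $ m $ k) * matrix_inv B $ k $ j)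
      = matrix_inv B $ i $ j - matrix_inv A $ i $ j"
    by (simp add: matrix_matrix_mult_def sum_distrib_right)
  then show ?thesis by (subst sum.swap) simp
qed

text \<open>By the resolvent identity the difference quotient is a product in which the inverse at
  the moving time s enters only through its continuity.\<close>

lemma has_real_derivative_matrix_inv:
  fixes f :: "real \<Rightarrow> real^'n^'n"
  assumes der: "\<And>i j. ((\<lambda>s. f s $ i $ j) has_real_derivative f' i j) (at t within S)"
    and det: "\<And>s. s \<in> S \<Longrightarrow> det (f s) \<noteq> 0" and "t \<in> S"
    and cont: "\<And>i j. continuous_on S (\<lambda>s. f s $ i $ j)"
  shows "((\<lambda>s. matrix_inv (f s) $ i $ j) has_real_derivative
    - (\<Sum>m\<in>UNIV. \<Sum>k\<in>UNIV. matrix_inv (f t) $ i $ m * f' m k * matrix_inv (f t) $ k $ j)) (at t within S)"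
proof -
  have "continuous_on S (\<lambda>s. matrix_inv (f s) $ i $ m)" for m
    by (intro continuous_on_matrix_inv cont det)
  then have inv: "((\<lambda>s. matrix_inv (f s) $ i $ m) \<longlongrightarrow> matrix_inv (f t) $ i $ m) (at t within S)" for m
    using \<open>t \<in> S\<close> by (simp add: continuous_on)
  have quot: "((\<lambda>s. (f s $ m $ k - f t $ m $ k) / (s - t)) \<longlongrightarrow> f' m k) (at t within S)" for m k
    using der by (simp add: has_field_derivative_iff)
  have "((\<lambda>s. - (\<Sum>m\<in>UNIV. \<Sum>k\<in>UNIV. matrix_inv (f s) $ i $ m * ((f s $ m $ k - f t $ m $ k) / (s - t))
      * matrix_inv (f t) $ k $ j)) \<longlongrightarrow>
    - (\<Sum>m\<in>UNIV. \<Sum>k\<in>UNIV. matrix_inv (f t) $ i $ m * f' m k * matrix_inv (f t) $ k $ j)) (at t within S)"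
    by (intro tendsto_intros inv quot)
  moreover have "\<forall>\<^sub>F s in at t within S. - (\<Sum>m\<in>UNIV. \<Sum>k\<in>UNIV. matrix_inv (f s) $ i $ m *
      ((f s $ m $ k - f t $ m $ k) / (s - t)) * matrix_inv (f t) $ k $ j) =
      (matrix_inv (f s) $ i $ j - matrix_inv (f t) $ i $ j) / (s - t)"
    unfolding eventually_at_filter
    by (rule always_eventually)
      (auto simp: matrix_inv_diff_nth[OF det det[OF \<open>t \<in> S\<close>]] sum_divide_distrib)
  ultimately show ?thesis
    unfolding has_field_derivative_iff by (rule Lim_transform_eventually)
qed

text \<open>Cramer's rule has shown the inverse to be smooth, so the product rule applies to
  \<open>matrix_inv g ** g = mat 1\<close>; multiplying by the inverse on the right isolates its
  derivative.\<close>

lemma partial_deriv_matrix_inv: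
  fixes g :: "real^'d \<Rightarrow> real^'d^'d"
  assumes op: "open \<Omega>" and sm: "\<And>i j. smooth_on \<Omega> (\<lambda>x. g x $ i $ j)"
    and det: "\<And>x. x \<in> \<Omega> \<Longrightarrow> det (g x) \<noteq> 0" and x: "x \<in> \<Omega>"
  shows "partial_deriv a (\<lambda>x. matrix_inv (g x) $ i $ j) x =
    - (\<Sum>m\<in>UNIV. \<Sum>k\<in>UNIV. matrix_inv (g x) $ i $ m * partial_deriv a (\<lambda>x. g x $ m $ k) x * matrix_inv (g x) $ k $ j)"
proof -
  let ?G = "\<lambda>i j x. matrix_inv (g x) $ i $ j"
  have smG: "smooth_on \<Omega> (?G i j)" for i j
    by (intro smooth_on_matrix_inv sm det)
  have *: "(\<Sum>m\<in>UNIV. partial_deriv a (?G i m) x * g x $ m $ k) =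
      - (\<Sum>m\<in>UNIV. ?G i m x * partial_deriv a (\<lambda>x. g x $ m $ k) x)" for k
  proof -
    have "partial_deriv a (\<lambda>x. \<Sum>m\<in>UNIV. ?G i m x * g x $ m $ k) x
        = partial_deriv a (\<lambda>x. if i = k then 1 else 0) x"
      using matrix_inv_left_nth[OF det] by (intro partial_deriv_cong[OF op _ x] smooth_on_sum smooth_on_mult smG sm)
    also have "\<dots> = 0" by (rule partial_deriv_const)
    finally show ?thesis
      by (simp add: partial_deriv_const partial_deriv_sum[OF op] partial_deriv_mult[OF op]
          smG sm smooth_on_mult x sum.distrib eq_neg_iff_add_eq_0)
  qed
  have "partial_deriv a (?G i j) x = (\<Sum>m\<in>UNIV. partial_deriv a (?G i m) x * (\<Sum>k\<in>UNIV. g x $ m $ k * ?G k j x))"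
    by (simp add: matrix_inv_right_nth[OF det[OF x]] if_distrib cong: if_cong)
  also have "\<dots> = (\<Sum>k\<in>UNIV. (\<Sum>m\<in>UNIV. partial_deriv a (?G i m) x * g x $ m $ k) * ?G k j x)"
    by (simp add: sum_distrib_left sum_distrib_right mult.assoc) (rule sum.swap)
  also have "\<dots> = - (\<Sum>k\<in>UNIV. \<Sum>m\<in>UNIV. ?G i m x * partial_deriv a (\<lambda>x. g x $ m $ k) x * ?G k j x)"
    unfolding * by (simp add: sum_distrib_right sum_negf)
  finally show ?thesis by (subst sum.swap)
qed

lemma levi_civita_christoffel:
  assumes op: "open (chart_image c)"
    and sm: "\<And>i j. smooth_on (chart_image c) (\<lambda>x. metric_coeff A h c x $ i $ j)"
    and det: "\<And>x. x \<in> chart_image c \<Longrightarrow> det (metric_coeff A h c x) \<noteq> 0"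
    and sym: "\<And>x i j. x \<in> chart_image c \<Longrightarrow> metric_coeff A h c x $ i $ j = metric_coeff A h c x $ j $ i"
  shows "levi_civita (chart_image c) (\<lambda>i j x. metric_coeff_inv A h c x $ i $ j) (christoffel A h c)"
proof
  let ?g = "\<lambda>i j x. metric_coeff A h c x $ i $ j" and ?G = "\<lambda>i j x. metric_coeff_inv A h c x $ i $ j"
  let ?\<Omega> = "chart_image c"
  show "open ?\<Omega>" by (rule op)
  show smG: "smooth_on ?\<Omega> (?G i j)" for i j
    unfolding metric_coeff_inv_def by (intro smooth_on_matrix_inv sm det)
  show "smooth_on ?\<Omega> (christoffel A h c k i j)" for k i j
    unfolding christoffel_def
    by (intro smooth_on_mult smooth_on_const smooth_on_sum smG smooth_on_add smooth_on_diff
        smooth_on_partial_deriv[OF op] sm)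
  show symG: "?G i j x = ?G j i x" if "x \<in> ?\<Omega>" for x i j
    unfolding metric_coeff_inv_def by (intro matrix_inv_symmetric det sym that)
  have sym': "partial_deriv a (?g i j) x = partial_deriv a (?g j i) x" if "x \<in> ?\<Omega>" for x a i j
    by (intro partial_deriv_cong[OF op sm that] sym)
  show "christoffel A h c k i j x = christoffel A h c k j i x" if "x \<in> ?\<Omega>" for x i j k
    unfolding christoffel_def using sym'[OF that, of _ i j] by (simp add: add.commute)
  show "partial_deriv a (?G i j) x = - (\<Sum>m\<in>UNIV. christoffel A h c i a m x * ?G m j x)
     - (\<Sum>m\<in>UNIV. christoffel A h c j a m x * ?G i m x)" if x: "x \<in> ?\<Omega>" for x a i j
  proof -
    \<comment> \<open>Christoffel symbols of the first kind. The sum \<open>L k m + L m k\<close>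
      recovers the derivative of the metric, which is metric compatibility with lowered
      indices.\<close>
    define L where "L m k = (partial_deriv a (?g m k) x + partial_deriv m (?g a k) x - partial_deriv k (?g a m) x) / 2" for m k
    have \<Gamma>: "christoffel A h c j a m x = (\<Sum>k\<in>UNIV. ?G j k x * L m k)" for j m
      by (simp add: christoffel_def L_def sum_divide_distrib)
    have L: "partial_deriv a (?g m k) x = L k m + L m k" for m k
      by (simp add: L_def sym'[OF x, of a k m] field_simps)
    have "(\<Sum>m\<in>UNIV. christoffel A h c i a m x * ?G m j x) = (\<Sum>m\<in>UNIV. \<Sum>k\<in>UNIV. ?G i m x * L k m * ?G k j x)"
      unfolding \<Gamma> sum_distrib_right by (rule sum.swap)
    moreover have "(\<Sum>m\<in>UNIV. christoffel A h c j a m x * ?G i m x) = (\<Sum>m\<in>UNIV. \<Sum>k\<in>UNIV. ?G i m x * L m k * ?G k j x)"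
      unfolding \<Gamma> sum_distrib_right by (simp add: symG[OF x, of j] mult_ac)
    moreover have "partial_deriv a (?G i j) x = - (\<Sum>m\<in>UNIV. \<Sum>k\<in>UNIV. ?G i m x * (L k m + L m k) * ?G k j x)"
      unfolding metric_coeff_inv_def L[symmetric]
      by (intro partial_deriv_matrix_inv[OF op] sm det x)
    ultimately show ?thesis
      by (simp add: algebra_simps sum.distrib)
  qed
qed

section \<open>Tangent vectors in charts\<close>

text \<open>Inverse to reading off the component \<open>X c\<close>: it carries coordinate vectors
  in the chart \<open>c\<close> to tangent vectors at \<open>p\<close>.\<close>

definition tvec_of ::
    "('m, 'd::finite) chart set \<Rightarrow> ('m, 'd) chart \<Rightarrow> 'm \<Rightarrow> real^'d \<Rightarrow> ('m, 'd) tvec" where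
  "tvec_of A c p v = (\<lambda>c'. if c' \<in> charts_at A p then transition_deriv c c' p v else 0)"

lemma coord_vec_eq_tvec_of: "coord_vec A c p i = tvec_of A c p (axis i 1)"
  by (simp add: coord_vec_def tvec_of_def)

lemma frechet_derivative_eq_sum_partial_deriv:
  assumes "f differentiable (at x)"
  shows "frechet_derivative f (at x) v = (\<Sum>i\<in>UNIV. v $ i * partial_deriv i f x)"
proof -
  have lin: "linear (frechet_derivative f (at x))"
    using assms by (simp add: linear_frechet_derivative)
  have "v = (\<Sum>i\<in>UNIV. (v $ i) *\<^sub>R axis i 1)"
    using basis_expansion[of v] by (simp add: scalar_mult_eq_scaleR)
  then have "frechet_derivative f (at x) v = frechet_derivative f (at x) (\<Sum>i\<in>UNIV. (v $ i) *\<^sub>R axis i 1)"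
    by simp
  also have "\<dots> = (\<Sum>i\<in>UNIV. v $ i * partial_deriv i f x)"
    by (simp add: linear_sum[OF lin] linear_scale[OF lin] partial_deriv_def)
  finally show ?thesis .
qed

lemma snd_in_chart_image: "p \<in> fst c \<Longrightarrow> snd c p \<in> chart_image c"
  by (simp add: chart_image_def)

context
  fixes M :: "'m::t2_space set" and A :: "('m, 'd::finite) chart set"
  assumes atlas: "smooth_atlas M A"
begin

lemma
  assumes "c \<in> A"
  shows open_chart_image: "open (chart_image c)"
    and chart_openin: "openin (top_of_set M) (fst c)"
    and chart_homeomorphism: "homeomorphism (fst c) (chart_image c) (snd c) (chart_inv c)"
    and chart_subset: "fst c \<subseteq> M"
  using atlas assms unfolding smooth_atlas_def by blast+

lemma
  assumes "c \<in> A"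
  shows chart_inv_snd: "p \<in> fst c \<Longrightarrow> chart_inv c (snd c p) = p"
    and snd_chart_inv: "x \<in> chart_image c \<Longrightarrow> snd c (chart_inv c x) = x"
    and chart_inv_in: "x \<in> chart_image c \<Longrightarrow> chart_inv c x \<in> fst c"
  using chart_homeomorphism[OF assms] by (auto simp: homeomorphism_def)

lemma exists_chart: "p \<in> M \<Longrightarrow> \<exists>c. c \<in> charts_at A p"
  using atlas unfolding smooth_atlas_def charts_at_def by blast

lemma open_chart_overlap:
  assumes "c \<in> A" "openin (top_of_set M) U"
  shows "open (snd c ` (fst c \<inter> U))"
proof -
  have "openin (top_of_set (fst c)) (fst c \<inter> U)"
  proof -
    obtain W where "open W" "U = M \<inter> W" using assms(2) by (auto simp: openin_open)
    then have "fst c \<inter> U = fst c \<inter> W" using chart_subset[OF assms(1)] by blast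
    then show ?thesis using \<open>open W\<close> by (auto simp: openin_open)
  qed
  then have "openin (top_of_set (chart_image c)) (snd c ` (fst c \<inter> U))"
    using homeomorphism_imp_open_map[OF chart_homeomorphism[OF assms(1)]] by blast
  then show ?thesis
    using openin_open_trans open_chart_image[OF assms(1)] by blast
qed

lemma has_derivative_transition:
  assumes "c \<in> charts_at A p" "c' \<in> charts_at A p"
  shows "((snd c' \<circ> chart_inv c) has_derivative transition_deriv c c' p) (at (snd c p))"
proof -
  have "open (snd c ` (fst c \<inter> fst c'))"
    using assms by (intro open_chart_overlap chart_openin) (auto simp: charts_at_def)
  moreover have "smooth_on (snd c ` (fst c \<inter> fst c')) (snd c' \<circ> chart_inv c)"
    using atlas assms by (auto simp: charts_at_def smooth_atlas_def)
  moreover have "snd c p \<in> snd c ` (fst c \<inter> fst c')"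
    using assms by (auto simp: charts_at_def)
  ultimately show ?thesis
    unfolding transition_deriv_def by (rule smooth_on_imp_has_derivative)
qed

text \<open>The chain rule, by which the differential of \<open>f\<close> does not depend on the
  chart. The two coordinate expressions agree only on the overlap, which is an open neighbourhood of
  the point.\<close>

lemma has_derivative_change_chart:
  assumes "c \<in> charts_at A p" "c' \<in> charts_at A p"
    and f: "((f \<circ> chart_inv c') has_derivative F) (at (snd c' p))"
  shows "((f \<circ> chart_inv c) has_derivative (\<lambda>v. F (transition_deriv c c' p v))) (at (snd c p))"
proof -
  have c: "c \<in> A" "c' \<in> A" "p \<in> fst c" "p \<in> fst c'" using assms by (auto simp: charts_at_def)
  have "((f \<circ> chart_inv c') has_derivative F) (at ((snd c' \<circ> chart_inv c) (snd c p)))"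
    using f by (simp add: chart_inv_snd c)
  then have "((f \<circ> chart_inv c') \<circ> (snd c' \<circ> chart_inv c) has_derivative F \<circ> transition_deriv c c' p) (at (snd c p))"
    by (intro diff_chain_at has_derivative_transition assms)
  then have "((f \<circ> chart_inv c') \<circ> (snd c' \<circ> chart_inv c) has_derivative (\<lambda>v. F (transition_deriv c c' p v))) (at (snd c p))"
    by (simp add: o_def)
  moreover have "open (snd c ` (fst c \<inter> fst c'))" "snd c p \<in> snd c ` (fst c \<inter> fst c')"
    using c by (auto intro: open_chart_overlap chart_openin)
  ultimately show ?thesis
    by (rule has_derivative_transform_within_open) (auto simp: chart_inv_snd c)
qed

lemma linear_transition_deriv:
  "c \<in> charts_at A p \<Longrightarrow> c' \<in> charts_at A p \<Longrightarrow> linear (transition_deriv c c' p)"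
  using has_derivative_transition has_derivative_linear by blast

lemma transition_deriv_self:
  assumes "c \<in> charts_at A p"
  shows "transition_deriv c c p v = v"
proof -
  have c: "c \<in> A" "p \<in> fst c" using assms by (auto simp: charts_at_def)
  have "((snd c \<circ> chart_inv c) has_derivative (\<lambda>v. v)) (at (snd c p))"
    by (rule has_derivative_transform_within_open[OF has_derivative_ident open_chart_image[OF c(1)]])
      (auto simp: snd_chart_inv c snd_in_chart_image)
  with has_derivative_transition[OF assms assms] show ?thesis
    by (metis has_derivative_unique)
qed

text \<open>The cocycle rule, from the uniqueness of the derivative of one change of coordinates
  computed in two ways.\<close>

lemma transition_deriv_trans:
  assumes "c \<in> charts_at A p" "c' \<in> charts_at A p" "c'' \<in> charts_at A p"
  shows "transition_deriv c' c'' p (transition_deriv c c' p v) = transition_deriv c c'' p v"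
  by (rule fun_cong[OF has_derivative_unique[OF has_derivative_change_chart[OF assms(1,2)
    has_derivative_transition[OF assms(2,3)]] has_derivative_transition[OF assms(1,3)]], THEN trans]) simp

lemma tvec_of_in_tangent_space: "c \<in> charts_at A p \<Longrightarrow> tvec_of A c p v \<in> tangent_space A p"
  by (auto simp: tangent_space_def tvec_of_def transition_deriv_trans)

lemma tvec_of_nth: "c \<in> charts_at A p \<Longrightarrow> tvec_of A c p v c = v"
  by (simp add: tvec_of_def transition_deriv_self)

lemma tangent_space_transition:
  assumes "X \<in> tangent_space A p" "c \<in> charts_at A p" "c' \<in> charts_at A p"
  shows "transition_deriv c c' p (X c) = X c'"
proof -
  have "\<forall>c\<in>charts_at A p. \<forall>c'\<in>charts_at A p. X c' = transition_deriv c c' p (X c)"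
    using assms(1) unfolding tangent_space_def by blast
  from this[THEN bspec, OF assms(2), THEN bspec, OF assms(3)] show ?thesis by (rule sym)
qed

lemma tvec_of_tangent:
  assumes "c \<in> charts_at A p" "X \<in> tangent_space A p"
  shows "tvec_of A c p (X c) = X"
proof
  have "\<forall>c. c \<notin> charts_at A p \<longrightarrow> X c = 0"
    using assms(2) unfolding tangent_space_def by blast
  then show "tvec_of A c p (X c) c' = X c'" for c'
  proof (cases "c' \<in> charts_at A p")
    case True
    then show ?thesis using tangent_space_transition[OF assms(2,1)] by (simp add: tvec_of_def)
  next
    case False
    with \<open>\<forall>c. _ c\<close> have "X c' = 0" by blast
    with False show ?thesis by (simp add: tvec_of_def)
  qed
qed

lemma tvec_of_sum:
  assumes "c \<in> charts_at A p"
  shows "tvec_of A c p (\<Sum>i\<in>I. a i *\<^sub>R v i) = (\<lambda>c'. \<Sum>i\<in>I. a i *\<^sub>R tvec_of A c p (v i) c')"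
proof
  show "tvec_of A c p (\<Sum>i\<in>I. a i *\<^sub>R v i) c' = (\<Sum>i\<in>I. a i *\<^sub>R tvec_of A c p (v i) c')" for c'
  proof (cases "c' \<in> charts_at A p")
    case True
    note lin = linear_transition_deriv[OF assms True]
    show ?thesis using True by (simp add: tvec_of_def linear_sum[OF lin] linear_scale[OF lin])
  qed (simp add: tvec_of_def)
qed

lemma tvec_of_0: "c \<in> charts_at A p \<Longrightarrow> tvec_of A c p 0 = (\<lambda>c. 0)"
  using tvec_of_sum[of c p _ _ "{}"] by simp

lemma riemannian_metric_sum:
  assumes h: "riemannian_metric M A h" and p: "p \<in> M" and c: "c \<in> charts_at A p"
    and Z: "Z \<in> tangent_space A p"
  shows "h p (tvec_of A c p (\<Sum>i\<in>I. a i *\<^sub>R v i)) Z = (\<Sum>i\<in>I. a i * h p (tvec_of A c p (v i)) Z)"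
proof -
  have lin: "h p (\<lambda>c. a *\<^sub>R X c + b *\<^sub>R Y c) Z = a * h p X Z + b * h p Y Z"
    if "X \<in> tangent_space A p" "Y \<in> tangent_space A p" for X Y a b
    using h p Z that unfolding riemannian_metric_def by blast
  note T = tvec_of_in_tangent_space[OF c]
  have zero: "h p (\<lambda>c. 0) Z = 0"
    using lin[of "tvec_of A c p 0" "tvec_of A c p 0" 0 0, OF T T] by simp
  show ?thesis
  proof (induction I rule: infinite_finite_induct)
    case (insert i I)
    have "tvec_of A c p (\<Sum>i\<in>insert i I. a i *\<^sub>R v i) =
        (\<lambda>c'. a i *\<^sub>R tvec_of A c p (v i) c' + 1 *\<^sub>R tvec_of A c p (\<Sum>i\<in>I. a i *\<^sub>R v i) c')"
      unfolding tvec_of_sum[OF c] using insert.hyps by simp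
    then show ?case
      using lin[OF T T, of "a i" "v i" 1 "\<Sum>i\<in>I. a i *\<^sub>R v i"] insert by simp
  qed (simp_all add: tvec_of_0[OF c] zero)
qed

lemma riemannian_metric_commute:
  "riemannian_metric M A h \<Longrightarrow> p \<in> M \<Longrightarrow> X \<in> tangent_space A p \<Longrightarrow> Y \<in> tangent_space A p \<Longrightarrow> h p X Y = h p Y X"
  unfolding riemannian_metric_def by blast

lemma riemannian_metric_coords:
  assumes h: "riemannian_metric M A h" and p: "p \<in> M" and c: "c \<in> charts_at A p"
    and X: "X \<in> tangent_space A p" and Y: "Y \<in> tangent_space A p"
  shows "h p X Y = (\<Sum>i\<in>UNIV. \<Sum>j\<in>UNIV. metric_coeff A h c (snd c p) $ i $ j * X c $ i * Y c $ j)"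
proof -
  have c': "c \<in> A" "p \<in> fst c" using c by (auto simp: charts_at_def)
  note T = tvec_of_in_tangent_space[OF c]
  have basis: "v = (\<Sum>i\<in>UNIV. (v $ i) *\<^sub>R axis i 1)" for v :: "real^'d"
    using basis_expansion[of v] by (simp add: scalar_mult_eq_scaleR)
  have "h p X Y = h p (tvec_of A c p (\<Sum>i\<in>UNIV. (X c $ i) *\<^sub>R axis i 1)) Y"
    by (metis basis tvec_of_tangent[OF c X])
  also have "\<dots> = (\<Sum>i\<in>UNIV. X c $ i * h p (tvec_of A c p (axis i 1)) Y)"
    by (rule riemannian_metric_sum[OF h p c Y])
  also have "\<dots> = (\<Sum>i\<in>UNIV. X c $ i * h p (tvec_of A c p (\<Sum>i\<in>UNIV. (Y c $ i) *\<^sub>R axis i 1)) (tvec_of A c p (axis i 1)))"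
    by (subst basis[symmetric]) (simp add: tvec_of_tangent[OF c Y] riemannian_metric_commute[OF h p T Y])
  also have "\<dots> = (\<Sum>i\<in>UNIV. \<Sum>j\<in>UNIV. X c $ i * (Y c $ j * h p (tvec_of A c p (axis j 1)) (tvec_of A c p (axis i 1))))"
    by (simp add: riemannian_metric_sum[OF h p c T] sum_distrib_left)
  also have "\<dots> = (\<Sum>i\<in>UNIV. \<Sum>j\<in>UNIV. metric_coeff A h c (snd c p) $ i $ j * X c $ i * Y c $ j)"
    by (simp add: metric_coeff_def chart_inv_snd c' coord_vec_eq_tvec_of
        riemannian_metric_commute[OF h p T T, of "axis j 1" "axis i 1" for i j] mult_ac)
  finally show ?thesis .
qed

lemma metric_coeff_symmetric:
  assumes h: "riemannian_metric M A h" and c: "c \<in> A" and x: "x \<in> chart_image c"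
  shows "metric_coeff A h c x $ i $ j = metric_coeff A h c x $ j $ i"
proof -
  have "c \<in> charts_at A (chart_inv c x)" "chart_inv c x \<in> M"
    using c chart_inv_in[OF c x] chart_subset[OF c] by (auto simp: charts_at_def)
  then show ?thesis
    unfolding metric_coeff_def coord_vec_eq_tvec_of
    using riemannian_metric_commute[OF h] tvec_of_in_tangent_space by simp
qed

lemma metric_coeff_pos:
  assumes h: "riemannian_metric M A h" and c: "c \<in> A" and x: "x \<in> chart_image c" and v: "v \<noteq> 0"
  shows "0 < (\<Sum>i\<in>UNIV. \<Sum>j\<in>UNIV. metric_coeff A h c x $ i $ j * v $ i * v $ j)"
proof -
  let ?p = "chart_inv c x"
  have c': "c \<in> charts_at A ?p" and p: "?p \<in> M"
    using c chart_inv_in[OF c x] chart_subset[OF c] by (auto simp: charts_at_def)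
  let ?X = "tvec_of A c ?p v"
  have X: "?X \<in> tangent_space A ?p" by (rule tvec_of_in_tangent_space[OF c'])
  have "?X \<noteq> (\<lambda>c. 0)" using tvec_of_nth[OF c', of v] v by metis
  then have "0 < h ?p ?X ?X" using h p X unfolding riemannian_metric_def by blast
  then show ?thesis
    unfolding riemannian_metric_coords[OF h p c' X X] by (simp add: tvec_of_nth[OF c'] snd_chart_inv c x)
qed

lemma det_metric_coeff:
  assumes h: "riemannian_metric M A h" and c: "c \<in> A" and x: "x \<in> chart_image c"
  shows "det (metric_coeff A h c x) \<noteq> 0"
proof -
  let ?g = "metric_coeff A h c x"
  have "v = 0" if "?g *v v = 0" for v
  proof (rule ccontr)
    assume "v \<noteq> 0"
    from metric_coeff_pos[OF h c x this]
    have "0 < (\<Sum>i\<in>UNIV. v $ i * (?g *v v) $ i)"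
      by (simp add: matrix_vector_mult_def sum_distrib_left mult_ac)
    then show False using that by simp
  qed
  then show ?thesis
    using invertible_det_nz[of ?g] matrix_left_invertible_ker[of ?g] invertible_left_inverse[of ?g] by blast
qed

lemma metric_coeff_mult_inv:
  assumes h: "riemannian_metric M A h" and c: "c \<in> A" and x: "x \<in> chart_image c"
  shows "(\<Sum>i\<in>UNIV. metric_coeff A h c x $ i $ j * (\<Sum>k\<in>UNIV. metric_coeff_inv A h c x $ i $ k * d k)) = d j"
proof -
  let ?g = "metric_coeff A h c x" and ?G = "metric_coeff_inv A h c x"
  have "(\<Sum>i\<in>UNIV. ?g $ i $ j * (\<Sum>k\<in>UNIV. ?G $ i $ k * d k)) =
      (\<Sum>i\<in>UNIV. ?g $ j $ i * (\<Sum>k\<in>UNIV. ?G $ i $ k * d k))"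
    using metric_coeff_symmetric[OF h c x] by simp
  also have "\<dots> = (\<Sum>k\<in>UNIV. (\<Sum>i\<in>UNIV. ?g $ j $ i * ?G $ i $ k) * d k)"
    by (simp add: sum_distrib_left sum_distrib_right mult.assoc) (rule sum.swap)
  finally show ?thesis
    by (simp add: metric_coeff_inv_def matrix_inv_right_nth[OF det_metric_coeff[OF h c x]] if_distrib
        if_distribR cong: if_cong)
qed

text \<open>Raising an index is an isometry: the metric undoes the inverse metric in one of the two
  slots.\<close>

lemma metric_coeff_gradient_norm:
  fixes d :: "'d \<Rightarrow> real"
  assumes h: "riemannian_metric M A h" and c: "c \<in> A" and x: "x \<in> chart_image c"
  defines "v \<equiv> \<lambda>i. \<Sum>j\<in>UNIV. metric_coeff_inv A h c x $ i $ j * d j"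
  shows "(\<Sum>i\<in>UNIV. \<Sum>j\<in>UNIV. metric_coeff A h c x $ i $ j * v i * v j) =
    (\<Sum>i\<in>UNIV. \<Sum>j\<in>UNIV. metric_coeff_inv A h c x $ i $ j * d i * d j)"
proof -
  have "(\<Sum>i\<in>UNIV. \<Sum>j\<in>UNIV. metric_coeff A h c x $ i $ j * v i * v j) =
      (\<Sum>j\<in>UNIV. (\<Sum>i\<in>UNIV. metric_coeff A h c x $ i $ j * v i) * v j)"
    unfolding sum_distrib_right by (rule sum.swap)
  also have "\<dots> = (\<Sum>j\<in>UNIV. d j * v j)"
    unfolding v_def metric_coeff_mult_inv[OF h c x] ..
  finally show ?thesis
    by (simp add: v_def sum_distrib_left mult_ac)
qed

text \<open>The value at a covector is the squared length of the vector obtained from it by raising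
  the index.\<close>

lemma metric_coeff_inv_nonneg:
  assumes h: "riemannian_metric M A h" and c: "c \<in> A" and x: "x \<in> chart_image c"
  shows "0 \<le> (\<Sum>i\<in>UNIV. \<Sum>j\<in>UNIV. metric_coeff_inv A h c x $ i $ j * (a i * a j))"
proof -
  define v :: "real^'d" where "v = (\<chi> i. \<Sum>j\<in>UNIV. metric_coeff_inv A h c x $ i $ j * a j)"
  have "0 \<le> (\<Sum>i\<in>UNIV. \<Sum>j\<in>UNIV. metric_coeff A h c x $ i $ j * v $ i * v $ j)"
    using metric_coeff_pos[OF h c x, of v] by (cases "v = 0") auto
  then show ?thesis
    using metric_coeff_gradient_norm[OF h c x, of a] by (simp add: v_def mult.assoc)
qed

lemma levi_civita_chart:
  assumes h: "riemannian_metric M A h" and c: "c \<in> A"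
  shows "levi_civita (chart_image c) (\<lambda>i j x. metric_coeff_inv A h c x $ i $ j) (christoffel A h c)"
  using h c by (intro levi_civita_christoffel open_chart_image det_metric_coeff metric_coeff_symmetric)
    (auto simp: riemannian_metric_def)

text \<open>To evaluate the definite description in \<open>gradient\<close>, the differential with
  raised index is shown to represent df, and to be the only tangent vector that does.\<close>

lemma metric_norm_gradient:
  assumes h: "riemannian_metric M A h" and p: "p \<in> M" and c: "c \<in> charts_at A p"
    and f: "(f \<circ> chart_inv c) differentiable (at (snd c p))"
  shows "(metric_norm h p (gradient A h f p))\<^sup>2 = (\<Sum>i\<in>UNIV. \<Sum>j\<in>UNIV. metric_coeff_inv A h c (snd c p) $ i $ j *
    partial_deriv i (f \<circ> chart_inv c) (snd c p) * partial_deriv j (f \<circ> chart_inv c) (snd c p))"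
proof -
  let ?x = "snd c p"
  let ?g = "metric_coeff A h c ?x" and ?G = "metric_coeff_inv A h c ?x"
  let ?d = "\<lambda>i. partial_deriv i (f \<circ> chart_inv c) ?x"
  have c': "c \<in> A" and x: "?x \<in> chart_image c"
    using c by (auto simp: charts_at_def snd_in_chart_image)
  note inv = matrix_inv_right_nth[OF det_metric_coeff[OF h c' x]] matrix_inv_left_nth[OF det_metric_coeff[OF h c' x]]
  define v :: "real^'d" where "v = (\<chi> i. \<Sum>j\<in>UNIV. ?G $ i $ j * ?d j)"
  let ?X = "tvec_of A c p v"
  have X: "?X \<in> tangent_space A p" by (rule tvec_of_in_tangent_space[OF c])
  have gv: "(\<Sum>i\<in>UNIV. ?g $ i $ j * v $ i) = ?d j" for j
    using metric_coeff_mult_inv[OF h c' x] by (simp add: v_def)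
  have deriv: "frechet_derivative (f \<circ> chart_inv c'') (at (snd c'' p)) (Y c'') = (\<Sum>j\<in>UNIV. Y c $ j * ?d j)"
    if "c'' \<in> charts_at A p" "Y \<in> tangent_space A p" for c'' Y
  proof -
    have "((f \<circ> chart_inv c) has_derivative frechet_derivative (f \<circ> chart_inv c) (at ?x)) (at ?x)"
      using f frechet_derivative_works by blast
    from has_derivative_change_chart[OF that(1) c this]
    have "frechet_derivative (f \<circ> chart_inv c'') (at (snd c'' p)) =
        (\<lambda>v. frechet_derivative (f \<circ> chart_inv c) (at ?x) (transition_deriv c'' c p v))"
      by (rule frechet_derivative_at[symmetric])
    moreover have "transition_deriv c'' c p (Y c'') = Y c"
      using that c by (intro tangent_space_transition)
    ultimately show ?thesis
      by (simp add: frechet_derivative_eq_sum_partial_deriv[OF f])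
  qed
  have hX: "h p ?X Y = (\<Sum>j\<in>UNIV. Y c $ j * ?d j)" if "Y \<in> tangent_space A p" for Y
  proof -
    have "h p ?X Y = (\<Sum>j\<in>UNIV. \<Sum>i\<in>UNIV. ?g $ i $ j * v $ i * Y c $ j)"
      unfolding riemannian_metric_coords[OF h p c X that] tvec_of_nth[OF c] by (rule sum.swap)
    then show ?thesis
      unfolding sum_distrib_right[symmetric] gv by (simp add: mult.commute)
  qed
  have "gradient A h f p = ?X"
    unfolding gradient_def
  proof (rule the_equality)
    show "?X \<in> tangent_space A p \<and> (\<forall>Y\<in>tangent_space A p. \<forall>c\<in>charts_at A p.
        h p ?X Y = frechet_derivative (f \<circ> chart_inv c) (at (snd c p)) (Y c))"
      using X hX deriv by simp
  next
    fix X' assume X': "X' \<in> tangent_space A p \<and> (\<forall>Y\<in>tangent_space A p. \<forall>c\<in>charts_at A p.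
        h p X' Y = frechet_derivative (f \<circ> chart_inv c) (at (snd c p)) (Y c))"
    \<comment> \<open>Testing against the coordinate vectors yields a linear system for the
      components, which the inverse metric then solves.\<close>
    have gX': "(\<Sum>i\<in>UNIV. ?g $ i $ j * X' c $ i) = ?d j" for j
    proof -
      let ?E = "tvec_of A c p (axis j 1)"
      have E: "?E \<in> tangent_space A p" by (rule tvec_of_in_tangent_space[OF c])
      have "h p X' ?E = (\<Sum>j\<in>UNIV. ?E c $ j * ?d j)"
        using X' E c deriv[OF c E] by simp
      then show ?thesis
        unfolding riemannian_metric_coords[OF h p c conjunct1[OF X'] E] tvec_of_nth[OF c]
        by (simp add: axis_def if_distrib if_distribR cong: if_cong)
    qed
    have "X' c $ k = v $ k" for k
    proof -
      have "v $ k = (\<Sum>j\<in>UNIV. ?G $ k $ j * (\<Sum>i\<in>UNIV. ?g $ j $ i * X' c $ i))"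
        using metric_coeff_symmetric[OF h c' x] gX' by (simp add: v_def)
      also have "\<dots> = (\<Sum>i\<in>UNIV. (\<Sum>j\<in>UNIV. ?G $ k $ j * ?g $ j $ i) * X' c $ i)"
        by (simp add: sum_distrib_left sum_distrib_right mult.assoc) (rule sum.swap)
      also have "\<dots> = X' c $ k"
        by (simp add: metric_coeff_inv_def inv if_distrib if_distribR cong: if_cong)
      finally show ?thesis by simp
    qed
    then have "X' c = v" by (simp add: vec_eq_iff)
    then show "X' = ?X" using tvec_of_tangent[OF c] X' by metis
  qed
  moreover have "h p ?X ?X = (\<Sum>i\<in>UNIV. \<Sum>j\<in>UNIV. ?G $ i $ j * ?d i * ?d j)"
    unfolding hX[OF X] tvec_of_nth[OF c] by (simp add: v_def sum_distrib_left sum_distrib_right mult_ac)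
  \<comment> \<open>Needed for the square of the square root in \<open>metric_norm\<close>.\<close>
  moreover have "0 \<le> h p ?X ?X"
    unfolding calculation(2) using metric_coeff_inv_nonneg[OF h c' x, of ?d] by (simp add: mult.assoc)
  ultimately show ?thesis by (simp add: metric_norm_def)
qed

end

section \<open>The heat equation for the logarithm\<close>

lemma has_derivative_slice:
  assumes "open S" "smooth_on S f" "(x, t) \<in> S"
  shows "((\<lambda>y. f (y, t)) has_derivative (\<lambda>v. frechet_derivative f (at (x, t)) (v, 0))) (at x)"
proof -
  have "((\<lambda>y. (y, t)) has_derivative (\<lambda>v. (v, 0))) (at x)"
    by (intro has_derivative_Pair has_derivative_ident has_derivative_const)
  moreover have "(f has_derivative frechet_derivative f (at (x, t))) (at (x, t))"
    by (rule smooth_on_imp_has_derivative[OF assms])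
  ultimately show ?thesis by (rule has_derivative_compose)
qed

lemma partial_deriv_slice:
  assumes "open S" "smooth_on S f" "(x, t) \<in> S"
  shows "partial_deriv i (\<lambda>y. f (y, t)) x = frechet_derivative f (at (x, t)) (axis i 1, 0)"
  using frechet_derivative_at[OF has_derivative_slice[OF assms]] by (metis partial_deriv_def)

lemma has_real_derivative_slice:
  fixes f :: "'a::euclidean_space \<times> real \<Rightarrow> real"
  assumes "open S" "smooth_on S f" "(x, t) \<in> S"
  shows "((\<lambda>s. f (x, s)) has_real_derivative frechet_derivative f (at (x, t)) (0, 1)) (at t)"
  using smooth_on_line_derivative[OF assms(1,2), of "(x, 0)" t "(0, 1)"] assms(3)
  by (simp add: has_real_derivative_iff_has_vector_derivative)

text \<open>Joint continuity is wanted up to the end times, where \<open>U \<times> I\<close> is no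
  neighbourhood. The derivative within that set provides it, since its spatial part is the ordinary
  derivative of the slice.\<close>

lemma continuous_on_partial_deriv_slice:
  fixes f :: "(real^'d) \<times> real \<Rightarrow> real"
  assumes "open U" "smooth_on (U \<times> I) f"
  shows "continuous_on (U \<times> I) (\<lambda>(x, t). partial_deriv i (\<lambda>y. f (y, t)) x)"
proof -
  have "Ck_on (Suc 0) (U \<times> I) f" using assms(2) by (simp add: smooth_on_def)
  then obtain f' where f': "\<And>z. z \<in> U \<times> I \<Longrightarrow> (f has_derivative f' z) (at z within U \<times> I)"
    "\<And>v. continuous_on (U \<times> I) (\<lambda>z. f' z v)"
    by auto
  have "partial_deriv i (\<lambda>y. f (y, t)) x = f' (x, t) (axis i 1, 0)" if "x \<in> U" "t \<in> I" for x t
  proof -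
    have 1: "((\<lambda>y. (y, t)) has_derivative (\<lambda>v. (v, 0))) (at x within U)"
      by (intro has_derivative_Pair has_derivative_ident has_derivative_const)
    have "(f has_derivative f' (x, t)) (at (x, t) within (\<lambda>y. (y, t)) ` U)"
      using that by (intro has_derivative_subset[OF f'(1)]) auto
    from has_derivative_in_compose[OF 1 this]
    have "((\<lambda>y. f (y, t)) has_derivative (\<lambda>v. f' (x, t) (v, 0))) (at x)"
      using at_within_open[OF that(1) assms(1)] by simp
    from frechet_derivative_at[OF this] show ?thesis by (metis partial_deriv_def)
  qed
  then show ?thesis
    using f'(2)[of "(axis i 1, 0)"] by (auto intro: continuous_on_eq)
qed

text \<open>Since \<open>U = exp F\<close> with \<open>F = ln U\<close>, the Laplacian picks up the term \<open>|\<nabla>F|\<^sup>2\<close>.\<close>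

context levi_civita
begin

lemma partial_deriv_ln:
  assumes "smooth_on \<Omega> U" "\<And>y. y \<in> \<Omega> \<Longrightarrow> 0 < U y" "x \<in> \<Omega>"
  shows "partial_deriv j (\<lambda>y. ln (U y)) x = partial_deriv j U x / U x"
proof -
  have "((\<lambda>y. ln (U y)) has_derivative (\<lambda>v. frechet_derivative U (at x) v / U x)) (at x)"
    using smooth_on_imp_has_derivative[OF op assms(1,3)] assms(2)[OF assms(3)]
    by (auto intro!: derivative_eq_intros simp: divide_inverse)
  from frechet_derivative_at[OF this] show ?thesis by (metis partial_deriv_def)
qed

lemma lap_ln:
  assumes U: "smooth_on \<Omega> U" and pos: "\<And>y. y \<in> \<Omega> \<Longrightarrow> 0 < U y" and x: "x \<in> \<Omega>"
  shows "lap U x = U x * (lap (\<lambda>y. ln (U y)) x + ip (differential (\<lambda>y. ln (U y))) (differential (\<lambda>y. ln (U y))) x)"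
proof -
  let ?F = "\<lambda>y. ln (U y)"
  have F: "smooth_on \<Omega> ?F" by (intro smooth_on_ln U pos)
  have first: "partial_deriv j U y = U y * partial_deriv j ?F y" if "y \<in> \<Omega>" for j y
    using partial_deriv_ln[OF U pos that] pos[OF that] by simp
  have "partial_deriv i (partial_deriv j U) x = partial_deriv i (\<lambda>y. U y * partial_deriv j ?F y) x" for i j
    by (intro partial_deriv_cong[OF op _ x] smooth_intros U first)
  then have "partial_deriv i (partial_deriv j U) x =
      U x * (partial_deriv i (partial_deriv j ?F) x + partial_deriv i ?F x * partial_deriv j ?F x)" for i j
    using x U F by (simp add: partial_deriv_mult[OF op] smooth_intros first algebra_simps)
  then show ?thesis
    unfolding lap_def first[OF x] ip_def differential_def
    by (simp add: algebra_simps sum.distrib sum_subtractf sum_distrib_left)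
qed

end

section \<open>The setting of the theorem, and the evolution of w and dw in a chart\<close>

locale heat_flow =
  fixes M :: "'m::t2_space set"
    and A :: "('m, 'd::finite) chart set"
    and T :: real
    and g :: "real \<Rightarrow> ('m, 'd) bilinear_field"
    and k :: "real \<Rightarrow> real"
    and u :: "'m \<Rightarrow> real \<Rightarrow> real"
  assumes compact: "compact M" and atlas: "smooth_atlas M A"
    and T_pos: "T > 0"
    and metric_family: "C1_metric_family M A T g"
    and k_cont: "continuous_on {0..T} k"
    and curvature_bound: "t \<in> {0..T} \<Longrightarrow> p \<in> M \<Longrightarrow> c \<in> charts_at A p \<Longrightarrow> X \<in> tangent_space A p \<Longrightarrow>
           ricci A (g t) c p X X + metric_time_deriv T g t p X X \<ge> - k t * g t p X X"
    and u_smooth: "smooth_spacetime A T u"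
    and u_pos: "p \<in> M \<Longrightarrow> t \<in> {0..T} \<Longrightarrow> u p t > 0"
    and heat: "heat_solution A T g u"
begin

definition logu :: "('m, 'd) chart \<Rightarrow> real \<Rightarrow> real^'d \<Rightarrow> real" where
  "logu c t x = ln (u (chart_inv c x) t)"

text \<open>The function N in coordinates, as the squared length of dw;
  \<open>gradient_energy\<close> relates it to the gradient of \<open>u\<close>.\<close>

definition energy :: "('m, 'd) chart \<Rightarrow> real \<Rightarrow> real^'d \<Rightarrow> real" where
  "energy c t x = (\<Sum>i\<in>UNIV. \<Sum>j\<in>UNIV. metric_coeff_inv A (g t) c x $ i $ j *
     partial_deriv i (logu c t) x * partial_deriv j (logu c t) x)"

lemma metric: "t \<in> {0..T} \<Longrightarrow> riemannian_metric M A (g t)"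
  using metric_family unfolding C1_metric_family_def by blast

lemma connection:
  "c \<in> A \<Longrightarrow> t \<in> {0..T} \<Longrightarrow>
    levi_civita (chart_image c) (\<lambda>i j x. metric_coeff_inv A (g t) c x $ i $ j) (christoffel A (g t) c)"
  using levi_civita_chart[OF atlas metric] by blast

lemma chart_inv_in_M: "c \<in> A \<Longrightarrow> x \<in> chart_image c \<Longrightarrow> chart_inv c x \<in> M"
  using chart_inv_in[OF atlas] chart_subset[OF atlas] by blast

lemma smooth_u_chart: "c \<in> A \<Longrightarrow> smooth_on (chart_image c \<times> {0..T}) (\<lambda>z. u (chart_inv c (fst z)) (snd z))"
  using u_smooth unfolding smooth_spacetime_def by (simp add: case_prod_beta')

lemma smooth_logu_spacetime: "c \<in> A \<Longrightarrow> smooth_on (chart_image c \<times> {0..T}) (\<lambda>z. logu c (snd z) (fst z))"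
  unfolding logu_def by (intro smooth_on_ln smooth_u_chart u_pos) (auto simp: chart_inv_in_M)

lemma smooth_u_slice: "c \<in> A \<Longrightarrow> t \<in> {0..T} \<Longrightarrow> smooth_on (chart_image c) (\<lambda>x. u (chart_inv c x) t)"
  using smooth_on_slice[OF smooth_u_chart] by simp

lemma smooth_logu: "c \<in> A \<Longrightarrow> t \<in> {0..T} \<Longrightarrow> smooth_on (chart_image c) (logu c t)"
  using smooth_on_slice[OF smooth_logu_spacetime] by simp

lemma logu_heat:
  assumes c: "c \<in> A" and x: "x \<in> chart_image c" and t: "t \<in> {0<..<T}"
  defines "lap \<equiv> levi_civita.lap (\<lambda>i j x. metric_coeff_inv A (g t) c x $ i $ j) (christoffel A (g t) c)"
  shows "((\<lambda>s. logu c s x) has_real_derivative (lap (logu c t) x + energy c t x) / 2) (at t)"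
proof -
  have t': "t \<in> {0..T}" using t by simp
  interpret L: levi_civita "chart_image c" "\<lambda>i j x. metric_coeff_inv A (g t) c x $ i $ j" "christoffel A (g t) c"
    by (rule connection[OF c t'])
  let ?p = "chart_inv c x"
  let ?U = "\<lambda>x. u (chart_inv c x) t"
  have p: "?p \<in> fst c" "?p \<in> M" "snd c ?p = x"
    using chart_inv_in[OF atlas c x] chart_inv_in_M[OF c x] snd_chart_inv[OF atlas c x] by auto
  have upos: "0 < u ?p t" using u_pos p t' by blast
  have "laplacian A (g t) c (\<lambda>q. u q t) ?p = L.lap ?U x"
    unfolding laplacian_def L.lap_def Let_def p(3) by (simp add: o_def)
  also have "\<dots> = u ?p t * (lap (logu c t) x + energy c t x)"
    unfolding lap_def energy_def logu_def[abs_def]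
    using L.lap_ln[OF smooth_u_slice[OF c t'] u_pos x] chart_inv_in_M[OF c] t'
    by (simp add: L.ip_def L.differential_def)
  finally have "laplacian A (g t) c (\<lambda>q. u q t) ?p = u ?p t * (lap (logu c t) x + energy c t x)" .
  moreover have "((\<lambda>s. u ?p s) has_real_derivative (1/2) * laplacian A (g t) c (\<lambda>q. u q t) ?p) (at t within {0..T})"
    using heat c p(1) t' unfolding heat_solution_def by blast
  moreover have "at t within {0..T} = at t"
    using t by (intro at_within_interior) (simp add: interior_atLeastAtMost_real)
  ultimately have "((\<lambda>s. u ?p s) has_real_derivative (1/2) * (u ?p t * (lap (logu c t) x + energy c t x))) (at t)"
    by simp
  then show ?thesis
    unfolding logu_def using upos
    by (auto intro!: derivative_eq_intros simp: field_simps)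
qed

text \<open>As a function of (x,t), w is smooth on the open set over \<open>{0<..<T}\<close>, so its
  derivatives in t and x commute there; what remains is a spatial derivative of the equation for w
  at a fixed time.\<close>

lemma partial_deriv_logu_heat:
  assumes c: "c \<in> A" and x: "x \<in> chart_image c" and t: "t \<in> {0<..<T}"
  defines "lap \<equiv> levi_civita.lap (\<lambda>i j x. metric_coeff_inv A (g t) c x $ i $ j) (christoffel A (g t) c)"
  shows "((\<lambda>s. partial_deriv i (logu c s) x) has_real_derivative
    (partial_deriv i (lap (logu c t)) x + partial_deriv i (energy c t) x) / 2) (at t)"
proof -
  have t': "t \<in> {0..T}" using t by simp
  interpret L: levi_civita "chart_image c" "\<lambda>i j x. metric_coeff_inv A (g t) c x $ i $ j" "christoffel A (g t) c"
    by (rule connection[OF c t'])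
  let ?S = "chart_image c \<times> {0<..<T}"
  let ?W = "\<lambda>z. logu c (snd z) (fst z)"
  have oS: "open ?S" by (intro open_Times open_chart_image[OF atlas c]) simp
  have W: "smooth_on ?S ?W"
    by (rule smooth_on_subset[OF smooth_logu_spacetime[OF c]]) auto
  note W' = smooth_on_frechet_derivative[OF oS W]
  have xt: "(x, t) \<in> ?S" using x t by simp
  have 1: "partial_deriv i (logu c s) x = frechet_derivative ?W (at (x, s)) (axis i 1, 0)" if "s \<in> {0<..<T}" for s
    using partial_deriv_slice[OF oS W, of x s i] x that by (simp add: fun_eq_iff cong: arg_cong2[where f = "partial_deriv i"])
  have 2: "frechet_derivative ?W (at (y, t)) (0, 1) = (lap (logu c t) y + energy c t y) / 2" if "y \<in> chart_image c" for y
    using has_real_derivative_slice[OF oS W, of y t] logu_heat[OF c that t] that t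
    unfolding lap_def by (intro DERIV_unique[of "\<lambda>s. logu c s y" _ t]) simp_all
  have smE: "smooth_on (chart_image c) (energy c t)" and smL: "smooth_on (chart_image c) (lap (logu c t))"
    unfolding energy_def[abs_def] lap_def L.lap_hess[abs_def]
    by (intro L.smooth_intros L.smooth_hess smooth_logu c t')+
  have "((\<lambda>s. frechet_derivative ?W (at (x, s)) (axis i 1, 0)) has_real_derivative
      frechet_derivative (\<lambda>z. frechet_derivative ?W (at z) (axis i 1, 0)) (at (x, t)) (0, 1)) (at t)"
    by (rule has_real_derivative_slice[OF oS W' xt])
  also have "frechet_derivative (\<lambda>z. frechet_derivative ?W (at z) (axis i 1, 0)) (at (x, t)) (0, 1) =
      frechet_derivative (\<lambda>z. frechet_derivative ?W (at z) (0, 1)) (at (x, t)) (axis i 1, 0)"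
    by (rule frechet_derivative_commute[OF oS W xt])
  also have "\<dots> = partial_deriv i (\<lambda>y. frechet_derivative ?W (at (y, t)) (0, 1)) x"
    by (rule partial_deriv_slice[OF oS W' xt, symmetric])
  also have "\<dots> = partial_deriv i (\<lambda>y. (1/2) * (lap (logu c t) y + energy c t y)) x"
    by (rule partial_deriv_cong[OF L.op, symmetric], intro L.smooth_intros smL smE) (simp_all add: x 2)
  also have "\<dots> = (partial_deriv i (lap (logu c t)) x + partial_deriv i (energy c t) x) / 2"
    by (subst partial_deriv_cmult[OF L.op])
      (simp_all add: partial_deriv_add[OF L.op] smE smL L.smooth_intros x)
  finally show ?thesis
    by (rule has_field_derivative_transform_within_open[of _ _ _ "{0<..<T}"]) (use t 1 in auto)
qed

lemma metric_coeff_has_time_deriv: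
  assumes c: "c \<in> A"
  obtains g' where "\<And>i j x t. x \<in> chart_image c \<Longrightarrow> t \<in> {0..T} \<Longrightarrow>
    ((\<lambda>s. metric_coeff A (g s) c x $ i $ j) has_real_derivative g' i j x t) (at t within {0..T})"
  using metric_family c unfolding C1_metric_family_def by metis

lemma metric_coeff_continuous:
  "c \<in> A \<Longrightarrow> continuous_on (chart_image c \<times> {0..T}) (\<lambda>z. metric_coeff A (g (snd z)) c (fst z) $ i $ j)"
  using metric_family unfolding C1_metric_family_def by (simp add: case_prod_beta')

end

section \<open>The evolution inequality\<close>

context heat_flow
begin

text \<open>At a spatial maximum of the quantity the upper bound for its time derivative is nonpositive.\<close>

lemma evolution_inequality:
  assumes c: "c \<in> A" and x: "x \<in> chart_image c" and t: "t \<in> {0<..<T}"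
    and \<phi>: "(\<phi> has_real_derivative 1/2 - k t * \<phi> t) (at t)" "0 \<le> \<phi> t"
  defines "lap \<equiv> levi_civita.lap (\<lambda>i j x. metric_coeff_inv A (g t) c x $ i $ j) (christoffel A (g t) c)"
    and "X \<equiv> \<lambda>i. \<Sum>j\<in>UNIV. metric_coeff_inv A (g t) c x $ i $ j * partial_deriv j (logu c t) x"
  obtains D where "((\<lambda>s. \<phi> s * energy c s x + logu c s x) has_real_derivative D) (at t)"
    "D \<le> lap (\<lambda>y. \<phi> t * energy c t y + logu c t y) x / 2
      + (\<Sum>i\<in>UNIV. X i * partial_deriv i (\<lambda>y. \<phi> t * energy c t y + logu c t y) x)"
proof -
  have t': "t \<in> {0..T}" using t by simp
  let ?G = "\<lambda>i j x. metric_coeff_inv A (g t) c x $ i $ j"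
  interpret L: levi_civita "chart_image c" ?G "christoffel A (g t) c"
    by (rule connection[OF c t'])
  let ?p = "chart_inv c x" and ?F = "logu c t" and ?N = "energy c t"
  let ?d = "\<lambda>i. partial_deriv i ?F x"
  note F = smooth_logu[OF c t']
  have N_eq: "?N = L.ip (L.differential ?F) (L.differential ?F)"
    by (simp add: fun_eq_iff energy_def L.ip_def L.differential_def)
  have smN: "smooth_on (chart_image c) ?N"
    unfolding N_eq by (intro L.smooth_ip L.smooth_differential F)
  have p: "?p \<in> fst c" "?p \<in> M" "snd c ?p = x" "c \<in> charts_at A ?p"
    using chart_inv_in[OF atlas c x] chart_inv_in_M[OF c x] snd_chart_inv[OF atlas c x] c
    by (auto simp: charts_at_def)
  have grad: "L.grad ?F i x = X i" for i
    by (simp add: L.grad_def X_def)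
  \<comment> \<open>Both index positions are recorded because the derivative of the inverse metric
    meets the gradient from its left and from its right.\<close>
  have X_eq: "X i = (\<Sum>j\<in>UNIV. ?G i j x * ?d j)" for i
    by (simp add: X_def)
  have X_sym: "X i = (\<Sum>j\<in>UNIV. ?G j i x * ?d j)" for i
    unfolding X_def by (subst L.G_sym[OF x]) simp
  have N_X: "?N x = (\<Sum>i\<in>UNIV. X i * ?d i)"
    by (simp add: energy_def X_def sum_distrib_left sum_distrib_right mult_ac)
  have interior: "at t within {0..T} = at t"
    using t by (intro at_within_interior) (simp add: interior_atLeastAtMost_real)
  obtain g' where g': "\<And>i j x t. x \<in> chart_image c \<Longrightarrow> t \<in> {0..T} \<Longrightarrow>
    ((\<lambda>s. metric_coeff A (g s) c x $ i $ j) has_real_derivative g' i j x t) (at t within {0..T})"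
    using metric_coeff_has_time_deriv[OF c] by blast
  have G': "((\<lambda>s. metric_coeff_inv A (g s) c x $ i $ j) has_real_derivative
      - (\<Sum>m\<in>UNIV. \<Sum>n\<in>UNIV. ?G i m x * g' m n x t * ?G n j x)) (at t)" for i j
    unfolding metric_coeff_inv_def interior[symmetric]
  proof (rule has_real_derivative_matrix_inv[OF g'[OF x t'] _ t'])
    show "det (metric_coeff A (g s) c x) \<noteq> 0" if "s \<in> {0..T}" for s
      by (rule det_metric_coeff[OF atlas metric[OF that] c x])
    show "continuous_on {0..T} (\<lambda>s. metric_coeff A (g s) c x $ i $ j)" for i j
      using g'[OF x] by (intro DERIV_continuous_on)
  qed
  define Y where "Y i = (partial_deriv i (lap ?F) x + partial_deriv i ?N x) / 2" for i
  have d': "((\<lambda>s. partial_deriv i (logu c s) x) has_real_derivative Y i) (at t)" for i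
    unfolding Y_def lap_def by (rule partial_deriv_logu_heat[OF c x t])
  define gXX where "gXX = (\<Sum>m\<in>UNIV. \<Sum>n\<in>UNIV. g' m n x t * X m * X n)"
  \<comment> \<open>Differentiating the inverse metric gives minus the time derivative of the metric
    on the raised vector; the two factors dw contribute equal terms by symmetry.\<close>
  have N': "((\<lambda>s. energy c s x) has_real_derivative - gXX + 2 * (\<Sum>i\<in>UNIV. X i * Y i)) (at t)"
  proof -
    have "((\<lambda>s. energy c s x) has_real_derivative
      (\<Sum>i\<in>UNIV. \<Sum>j\<in>UNIV. (- (\<Sum>m\<in>UNIV. \<Sum>n\<in>UNIV. ?G i m x * g' m n x t * ?G n j x) * ?d i + Y i * ?G i j x) * ?d j
        + Y j * (?G i j x * ?d i))) (at t)"
      unfolding energy_def by (intro DERIV_sum DERIV_mult G' d')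
    moreover have "(\<Sum>i\<in>UNIV. \<Sum>j\<in>UNIV. (\<Sum>m\<in>UNIV. \<Sum>n\<in>UNIV. ?G i m x * g' m n x t * ?G n j x) * ?d i * ?d j) = gXX"
    proof -
      have "gXX = (\<Sum>m\<in>UNIV. \<Sum>n\<in>UNIV. g' m n x t * ((\<Sum>i\<in>UNIV. ?G i m x * ?d i) * (\<Sum>j\<in>UNIV. ?G n j x * ?d j)))"
        by (simp only: gXX_def X_sym[symmetric] X_eq[symmetric] mult.assoc)
      also have "\<dots> = (\<Sum>m\<in>UNIV. \<Sum>n\<in>UNIV. \<Sum>i\<in>UNIV. \<Sum>j\<in>UNIV. g' m n x t * ((?G i m x * ?d i) * (?G n j x * ?d j)))"
        unfolding sum_product unfolding sum_distrib_left ..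
      also have "\<dots> = (\<Sum>i\<in>UNIV. \<Sum>j\<in>UNIV. \<Sum>m\<in>UNIV. \<Sum>n\<in>UNIV. g' m n x t * ((?G i m x * ?d i) * (?G n j x * ?d j)))"
        by (rule sum_swap_pairs)
      finally show ?thesis
        unfolding sum_distrib_right by (simp add: mult_ac)
    qed
    moreover have "(\<Sum>i\<in>UNIV. \<Sum>j\<in>UNIV. Y i * ?G i j x * ?d j) = (\<Sum>i\<in>UNIV. X i * Y i)"
      by (simp add: X_def sum_distrib_left sum_distrib_right mult_ac)
    moreover have "(\<Sum>i\<in>UNIV. \<Sum>j\<in>UNIV. Y j * (?G i j x * ?d i)) = (\<Sum>i\<in>UNIV. X i * Y i)"
      by (subst sum.swap) (simp add: X_sym sum_distrib_left sum_distrib_right mult_ac)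
    ultimately show ?thesis
      by (simp add: distrib_right left_diff_distrib sum.distrib sum_subtractf sum_negf)
  qed
  define D where "D = (1/2 - k t * \<phi> t) * ?N x + (- gXX + 2 * (\<Sum>i\<in>UNIV. X i * Y i)) * \<phi> t + (lap ?F x + ?N x) / 2"
  show ?thesis
  proof (rule that)
    show "((\<lambda>s. \<phi> s * energy c s x + logu c s x) has_real_derivative D) (at t)"
      unfolding D_def lap_def by (intro DERIV_add DERIV_mult \<phi> N' logu_heat c x t)
    define H where "H = (\<Sum>a\<in>UNIV. \<Sum>b\<in>UNIV. ?G a b x * L.ip (L.hess ?F a) (L.hess ?F b) x)"
    define Ric where "Ric = (\<Sum>i\<in>UNIV. \<Sum>j\<in>UNIV. (\<Sum>l\<in>UNIV. L.curv l j l i x) * X i * X j)"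
    have bochner: "lap ?N x / 2 = H + (\<Sum>i\<in>UNIV. X i * partial_deriv i (lap ?F) x) + Ric"
      using L.bochner[OF F x] unfolding H_def Ric_def lap_def N_eq grad .
    have "0 \<le> H"
      unfolding H_def by (intro L.hess_norm_nonneg metric_coeff_inv_nonneg[OF atlas metric] t' c x)
    have ric: "0 \<le> Ric + gXX + k t * ?N x"
    proof -
      \<comment> \<open>The gradient of w as a tangent vector, to which the curvature bound is
        applied.\<close>
      let ?Z = "tvec_of A c ?p (\<chi> i. X i)"
      have Z: "?Z \<in> tangent_space A ?p" "\<And>i. ?Z c $ i = X i"
        using tvec_of_in_tangent_space[OF atlas p(4)] tvec_of_nth[OF atlas p(4)] by simp_all
      have coords: "g s ?p ?Z ?Z = (\<Sum>i\<in>UNIV. \<Sum>j\<in>UNIV. metric_coeff A (g s) c x $ i $ j * X i * X j)"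
        if "s \<in> {0..T}" for s
        using riemannian_metric_coords[OF atlas metric[OF that] p(2,4) Z(1) Z(1)] by (simp add: Z p)
      have "g t ?p ?Z ?Z = ?N x"
        using coords[OF t'] metric_coeff_gradient_norm[OF atlas metric[OF t'] c x, of ?d]
        unfolding energy_def X_def by (rule trans)
      moreover have "metric_time_deriv T g t ?p ?Z ?Z = gXX"
      proof -
        have "((\<lambda>s. \<Sum>i\<in>UNIV. \<Sum>j\<in>UNIV. metric_coeff A (g s) c x $ i $ j * X i * X j)
            has_real_derivative gXX) (at t within {0..T})"
          unfolding gXX_def by (intro DERIV_sum DERIV_cmult_right g' x t')
        then have "((\<lambda>s. g s ?p ?Z ?Z) has_real_derivative gXX) (at t within {0..T})"
          by (rule has_field_derivative_transform_within[OF _ zero_less_one t']) (simp add: coords)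
        then show ?thesis
          unfolding metric_time_deriv_def has_real_derivative_iff_has_vector_derivative
          by (intro vector_derivative_within_closed_interval T_pos t')
      qed
      moreover have "ricci A (g t) c ?p ?Z ?Z = Ric"
        unfolding ricci_def Ric_def Z p(3) curvature_coeff_def L.curv_def ..
      ultimately show ?thesis
        using curvature_bound[OF t' p(2,4) Z(1)] by simp
    qed
    have pd: "partial_deriv i (\<lambda>y. \<phi> t * ?N y + ?F y) x = \<phi> t * partial_deriv i ?N x + ?d i" for i
      by (simp add: partial_deriv_add[OF L.op] partial_deriv_cmult[OF L.op] L.smooth_intros smN F x)
    have "lap (\<lambda>y. \<phi> t * ?N y + ?F y) x / 2 + (\<Sum>i\<in>UNIV. X i * partial_deriv i (\<lambda>y. \<phi> t * ?N y + ?F y) x) =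
      \<phi> t * (lap ?N x / 2) + lap ?F x / 2 + \<phi> t * (\<Sum>i\<in>UNIV. X i * partial_deriv i ?N x) + ?N x"
      unfolding pd N_X lap_def L.lap_linear[OF smN F x]
      by (simp add: algebra_simps sum.distrib sum_distrib_left add_divide_distrib)
    \<comment> \<open>An exact identity. Of the summand N, one half belongs to the time derivative
      of w, and 1/2 - \<phi>' leaves \<open>k t * \<phi> t\<close> times N; Bochner's formula
      supplies the Hessian and Ricci terms.\<close>
    also have "\<dots> = D + \<phi> t * (H + (Ric + gXX + k t * ?N x))"
    proof -
      have "2 * (\<Sum>i\<in>UNIV. X i * Y i) = (\<Sum>i\<in>UNIV. X i * partial_deriv i (lap ?F) x) + (\<Sum>i\<in>UNIV. X i * partial_deriv i ?N x)"
        unfolding Y_def sum_distrib_left sum.distrib[symmetric] by (intro sum.cong refl) (simp add: algebra_simps)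
      then show ?thesis
        unfolding D_def bochner by (simp add: field_simps)
    qed
    finally show "D \<le> lap (\<lambda>y. \<phi> t * ?N y + ?F y) x / 2
        + (\<Sum>i\<in>UNIV. X i * partial_deriv i (\<lambda>y. \<phi> t * ?N y + ?F y) x)"
      using \<open>0 \<le> H\<close> ric \<phi>(2) by simp
  qed
qed

end

section \<open>The maximum principle\<close>

text \<open>If the second derivative along v were positive, the first, being zero at x, would be
  positive just beyond x, and the mean value theorem would give a value larger than the
  maximum.\<close>

lemma second_derivative_at_max_nonpos:
  fixes f :: "'a::euclidean_space \<Rightarrow> real"
  assumes op: "open S" and f: "smooth_on S f" and x: "x \<in> S" and max: "\<And>y. y \<in> S \<Longrightarrow> f y \<le> f x"
  shows "frechet_derivative f (at x) v = 0"
    and "frechet_derivative (\<lambda>y. frechet_derivative f (at y) v) (at x) v \<le> 0"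
proof -
  let ?f1 = "\<lambda>y. frechet_derivative f (at y) v"
  note f1 = smooth_on_frechet_derivative[OF op f, of v]
  show zero: "?f1 x = 0"
    using differential_zero_maxmin[OF x op smooth_on_imp_has_derivative[OF op f x]] max by metis
  show "frechet_derivative ?f1 (at x) v \<le> 0"
  proof (rule ccontr)
    assume "\<not> ?thesis"
    then have pos: "0 < frechet_derivative ?f1 (at x) v" by simp
    have "((\<lambda>r. ?f1 (x + r *\<^sub>R v)) has_real_derivative frechet_derivative ?f1 (at x) v) (at 0)"
      using smooth_on_line_derivative[OF op f1, of x 0 v] x
      by (simp add: has_real_derivative_iff_has_vector_derivative)
    from DERIV_pos_inc_right[OF this pos]
    obtain d where d: "d > 0" "\<And>r. 0 < r \<Longrightarrow> r < d \<Longrightarrow> 0 < ?f1 (x + r *\<^sub>R v)"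
      using zero by auto
    have "((\<lambda>r. x + r *\<^sub>R v) \<longlongrightarrow> x + 0 *\<^sub>R v) (at 0)" by (intro tendsto_intros)
    then have "\<forall>\<^sub>F r in at 0. x + r *\<^sub>R v \<in> S"
      using op x by (auto dest: topological_tendstoD)
    then obtain e where e: "e > 0" "\<And>r. r \<noteq> 0 \<Longrightarrow> \<bar>r\<bar> < e \<Longrightarrow> x + r *\<^sub>R v \<in> S"
      unfolding eventually_at by (auto simp: dist_real_def)
    define h where "h = min d e / 2"
    have h: "0 < h" "h < d" "h < e" using d(1) e(1) by (auto simp: h_def)
    have inS: "x + r *\<^sub>R v \<in> S" if "0 \<le> r" "r \<le> h" for r
      using e(2)[of r] x that h by (cases "r = 0") auto
    have "((\<lambda>r. f (x + r *\<^sub>R v)) has_real_derivative ?f1 (x + r *\<^sub>R v)) (at r)" if "0 \<le> r" "r \<le> h" for r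
      using smooth_on_line_derivative[OF op f inS[OF that]]
      by (simp add: has_real_derivative_iff_has_vector_derivative)
    from MVT2[OF h(1) this] obtain r where r: "0 < r" "r < h"
      "f (x + h *\<^sub>R v) - f x = h * ?f1 (x + r *\<^sub>R v)" by auto
    have "0 < h * ?f1 (x + r *\<^sub>R v)" using d(2)[of r] r h by simp
    then show False using r(3) max[OF inS[of h]] h by simp
  qed
qed

context levi_civita
begin

text \<open>The Christoffel terms carry first derivatives and vanish. What is left pairs the
  semidefinite inverse metric with the matrix of second derivatives, whose negative is semidefinite
  at a maximum.\<close>

lemma lap_at_max_nonpos:
  assumes f: "smooth_on \<Omega> f" and x: "x \<in> \<Omega>" and max: "\<And>y. y \<in> \<Omega> \<Longrightarrow> f y \<le> f x"
    and psd: "\<And>a. 0 \<le> (\<Sum>i\<in>UNIV. \<Sum>j\<in>UNIV. G i j x * (a i * a j))"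
  shows "partial_deriv i f x = 0" and "lap f x \<le> 0"
proof -
  show zero: "partial_deriv i f x = 0" for i
    unfolding partial_deriv_def by (rule second_derivative_at_max_nonpos[OF op f x max])
  have diff: "h differentiable (at y)" if "smooth_on \<Omega> h" "y \<in> \<Omega>" for h :: "real^'d \<Rightarrow> real" and y
    using smooth_on_imp_has_derivative[OF op that] by (rule differentiableI)
  have "0 \<le> (\<Sum>i\<in>UNIV. \<Sum>j\<in>UNIV. G i j x * - partial_deriv i (partial_deriv j f) x)"
  proof (rule sum_mult_psd_nonneg)
    fix a :: "'d \<Rightarrow> real"
    \<comment> \<open>The quadratic form of the second derivatives at \<open>a\<close> is the second
      derivative along this vector.\<close>
    let ?v = "(\<chi> i. a i) :: real^'d"
    let ?f1 = "\<lambda>y. frechet_derivative f (at y) ?v"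
    have pd: "partial_deriv i ?f1 x = (\<Sum>j\<in>UNIV. a j * partial_deriv i (partial_deriv j f) x)" for i
    proof -
      have "partial_deriv i ?f1 x = partial_deriv i (\<lambda>y. \<Sum>j\<in>UNIV. a j * partial_deriv j f y) x"
        by (rule partial_deriv_cong[OF op smooth_on_frechet_derivative[OF op f] x])
          (simp add: frechet_derivative_eq_sum_partial_deriv[OF diff[OF f]])
      also have "\<dots> = (\<Sum>j\<in>UNIV. a j * partial_deriv i (partial_deriv j f) x)"
        using f x by (simp add: partial_deriv_sum[OF op] partial_deriv_cmult[OF op] smooth_intros)
      finally show ?thesis .
    qed
    have "frechet_derivative ?f1 (at x) ?v = (\<Sum>i\<in>UNIV. a i * partial_deriv i ?f1 x)"
      using frechet_derivative_eq_sum_partial_deriv[OF diff[OF smooth_on_frechet_derivative[OF op f] x]] by simp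
    then have "frechet_derivative ?f1 (at x) ?v =
        (\<Sum>i\<in>UNIV. \<Sum>j\<in>UNIV. partial_deriv i (partial_deriv j f) x * (a i * a j))"
      unfolding pd by (simp add: sum_distrib_left mult_ac)
    then show "0 \<le> (\<Sum>i\<in>UNIV. \<Sum>j\<in>UNIV. - partial_deriv i (partial_deriv j f) x * (a i * a j))"
      using second_derivative_at_max_nonpos(2)[OF op f x max, of ?v] by (simp add: sum_negf)
  qed (use psd G_sym[OF x] in auto)
  then show "lap f x \<le> 0"
    unfolding lap_def zero by (simp add: sum_negf)
qed

end

text \<open>Glues continuity from chart domains, which are open only relative to
  \<open>M\<close>.\<close>

lemma continuous_on_openin_local:
  fixes f :: "'a::t2_space \<Rightarrow> 'b::topological_space"
  assumes "\<And>z. z \<in> S \<Longrightarrow> \<exists>U. openin (top_of_set S) U \<and> z \<in> U \<and> continuous_on U f"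
  shows "continuous_on S f"
  unfolding continuous_on_eq_continuous_within
proof
  fix z assume z: "z \<in> S"
  then obtain U where U: "openin (top_of_set S) U" "z \<in> U" "continuous_on U f" using assms by blast
  then obtain W where W: "open W" "U = S \<inter> W" by (auto simp: openin_open)
  have "at z within S = at z within U"
    using U W by (intro at_within_nhd[of z W]) auto
  moreover have "continuous (at z within U) f"
    using U continuous_on_eq_continuous_within by blast
  ultimately show "continuous (at z within S) f" by simp
qed

context heat_flow
begin

section \<open>The weight \<phi>\<close>

definition weight :: "real \<Rightarrow> real" where
  "weight t = integral {0..t} (\<lambda>s. exp (- integral {s..t} k)) / 2"

text \<open>With K the integral of \<open>k\<close> from 0, the inner integral is
  \<open>K t - K s\<close>. Thus \<open>exp (- K t)\<close> leaves the outer integral, and t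
  survives in its upper limit only, so the fundamental theorem applies.\<close>

lemma
  shows weight_has_derivative:
      "t \<in> {0..T} \<Longrightarrow> (weight has_real_derivative 1/2 - k t * weight t) (at t within {0..T})"
    and weight_pos: "t \<in> {0<..T} \<Longrightarrow> 0 < weight t"
proof -
  define K where "K t = integral {0..t} k" for t
  define J where "J t = integral {0..t} (\<lambda>s. exp (K s))" for t
  have K': "(K has_real_derivative k t) (at t within {0..T})" if "t \<in> {0..T}" for t
    unfolding K_def by (rule integral_has_real_derivative[OF k_cont that])
  have K_cont: "continuous_on {0..T} (\<lambda>s. exp (K s))"
    using K' by (intro continuous_intros DERIV_continuous_on)
  have J': "(J has_real_derivative exp (K t)) (at t within {0..T})" if "t \<in> {0..T}" for t
    unfolding J_def by (rule integral_has_real_derivative[OF K_cont that])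
  have weight_eq: "weight t = exp (- K t) * J t / 2" if t: "t \<in> {0..T}" for t
  proof -
    have "integral {s..t} k = K t - K s" if "s \<in> {0..t}" for s
    proof -
      have "k integrable_on {0..t}"
        using t by (intro integrable_continuous_real continuous_on_subset[OF k_cont]) auto
      then have "K s + integral {s..t} k = K t"
        unfolding K_def using that by (intro Henstock_Kurzweil_Integration.integral_combine) auto
      then show ?thesis by simp
    qed
    then have "integral {0..t} (\<lambda>s. exp (- integral {s..t} k)) = integral {0..t} (\<lambda>s. exp (- K t) * exp (K s))"
      by (intro integral_cong) (simp add: exp_add[symmetric])
    then show ?thesis by (simp add: weight_def J_def)
  qed
  show "(weight has_real_derivative 1/2 - k t * weight t) (at t within {0..T})" if t: "t \<in> {0..T}" for t
  proof -
    have "((\<lambda>t. exp (- K t) * J t / 2) has_real_derivative 1/2 - k t * weight t) (at t within {0..T})"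
      using K'[OF t] J'[OF t]
      by (auto intro!: derivative_eq_intros simp: weight_eq[OF t] exp_minus field_simps)
    then show ?thesis
      by (rule has_field_derivative_transform_within[OF _ zero_less_one t]) (simp add: weight_eq)
  qed
  show "0 < weight t" if t: "t \<in> {0<..T}" for t
  proof -
    have sub: "{0..t} \<subseteq> {0..T}" using t by auto
    \<comment> \<open>The minimum of the integrand on the compact interval bounds the integral below
      by a positive number.\<close>
    obtain s where s: "s \<in> {0..t}" "\<And>r. r \<in> {0..t} \<Longrightarrow> exp (K s) \<le> exp (K r)"
      using continuous_attains_inf[OF compact_Icc _ continuous_on_subset[OF K_cont sub]] t by auto
    have "0 < t * exp (K s)" using t by simp
    also have "\<dots> = integral {0..t} (\<lambda>r. exp (K s))" using t by simp
    also have "\<dots> \<le> J t"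
      unfolding J_def using s
      by (intro integral_le integrable_continuous_real continuous_on_subset[OF K_cont sub]) auto
    finally show ?thesis using t by (simp add: weight_eq)
  qed
qed

lemma weight_0: "weight 0 = 0"
  by (simp add: weight_def)

lemma weight_nonneg: "t \<in> {0..T} \<Longrightarrow> 0 \<le> weight t"
  using weight_pos[of t] weight_0 by (cases "t = 0") auto

section \<open>The quantity Q as a continuous function on all of spacetime\<close>

lemma gradient_energy:
  assumes c: "c \<in> A" and x: "x \<in> chart_image c" and t: "t \<in> {0..T}"
  shows "(metric_norm (g t) (chart_inv c x) (gradient A (g t) (\<lambda>y. u y t) (chart_inv c x)))\<^sup>2
    / (u (chart_inv c x) t)\<^sup>2 = energy c t x"
proof -
  interpret L: levi_civita "chart_image c" "\<lambda>i j x. metric_coeff_inv A (g t) c x $ i $ j" "christoffel A (g t) c"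
    by (rule connection[OF c t])
  let ?p = "chart_inv c x" and ?U = "\<lambda>x. u (chart_inv c x) t"
  have p: "?p \<in> M" "snd c ?p = x" "c \<in> charts_at A ?p"
    using chart_inv_in[OF atlas c x] chart_inv_in_M[OF c x] snd_chart_inv[OF atlas c x] c
    by (auto simp: charts_at_def)
  note U = smooth_u_slice[OF c t]
  have upos: "0 < ?U y" if "y \<in> chart_image c" for y
    using u_pos chart_inv_in_M[OF c that] t by blast
  have comp: "(\<lambda>y. u y t) \<circ> chart_inv c = ?U" by (simp add: o_def)
  have "?U differentiable (at x)"
    using smooth_on_imp_has_derivative[OF L.op U x] by (rule differentiableI)
  then have "(metric_norm (g t) ?p (gradient A (g t) (\<lambda>y. u y t) ?p))\<^sup>2 =
      (\<Sum>i\<in>UNIV. \<Sum>j\<in>UNIV. metric_coeff_inv A (g t) c x $ i $ j * partial_deriv i ?U x * partial_deriv j ?U x)"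
    using metric_norm_gradient[OF atlas metric[OF t] p(1,3), of "\<lambda>y. u y t"] by (simp add: p comp)
  moreover have "partial_deriv i (logu c t) x = partial_deriv i ?U x / ?U x" for i
    unfolding logu_def[abs_def] by (rule L.partial_deriv_ln[OF U upos x])
  ultimately show ?thesis
    unfolding energy_def by (simp add: sum_divide_distrib power2_eq_square)
qed

text \<open>Q, written with the gradient instead of coordinates, so that one function is defined on
  all of \<open>M\<close> and its maximum can be taken over a compact set.\<close>

definition harnack_quantity :: "'m \<Rightarrow> real \<Rightarrow> real" where
  "harnack_quantity p t = weight t * ((metric_norm (g t) p (gradient A (g t) (\<lambda>y. u y t) p))\<^sup>2 / (u p t)\<^sup>2) + ln (u p t)"

lemma harnack_quantity_chart:
  "c \<in> A \<Longrightarrow> x \<in> chart_image c \<Longrightarrow> t \<in> {0..T} \<Longrightarrow> harnack_quantity (chart_inv c x) t = weight t * energy c t x + logu c t x"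
  unfolding harnack_quantity_def gradient_energy by (simp add: logu_def)

lemma continuous_on_charts:
  assumes f: "\<And>c. c \<in> A \<Longrightarrow> continuous_on (chart_image c \<times> {0..T}) (\<lambda>z. f (chart_inv c (fst z)) (snd z))"
  shows "continuous_on (M \<times> {0..T}) (\<lambda>z. f (fst z) (snd z))"
proof (rule continuous_on_openin_local)
  fix z assume z: "z \<in> M \<times> {0..T}"
  then obtain c where c: "c \<in> A" "fst z \<in> fst c"
    using exists_chart[OF atlas, of "fst z"] by (auto simp: charts_at_def)
  have "continuous_on (fst c) (snd c)"
    using chart_homeomorphism[OF atlas c(1)] by (simp add: homeomorphism_def)
  then have "continuous_on (fst c \<times> {0..T}) (\<lambda>z. snd c (fst z))"
    by (rule continuous_on_compose2[OF _ continuous_on_fst[OF continuous_on_id]]) auto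
  then have "continuous_on (fst c \<times> {0..T}) (\<lambda>z. (snd c (fst z), snd z))"
    by (intro continuous_on_Pair continuous_on_snd continuous_on_id)
  moreover have "(\<lambda>z. (snd c (fst z), snd z)) ` (fst c \<times> {0..T}) \<subseteq> chart_image c \<times> {0..T}"
    by (auto simp: snd_in_chart_image)
  ultimately have "continuous_on (fst c \<times> {0..T}) (\<lambda>z. f (chart_inv c (snd c (fst z))) (snd z))"
    using continuous_on_compose2[OF f[OF c(1)]] by fastforce
  then have "continuous_on (fst c \<times> {0..T}) (\<lambda>z. f (fst z) (snd z))"
    by (rule continuous_on_eq) (auto simp: chart_inv_snd[OF atlas c(1)])
  moreover have "openin (top_of_set (M \<times> {0..T})) (fst c \<times> {0..T})"
    using chart_openin[OF atlas c(1)] by (intro openin_Times) auto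
  ultimately show "\<exists>U. openin (top_of_set (M \<times> {0..T})) U \<and> z \<in> U \<and> continuous_on U (\<lambda>z. f (fst z) (snd z))"
    using z c by (intro exI[of _ "fst c \<times> {0..T}"]) (auto simp: mem_Times_iff)
qed

lemma continuous_on_u: "continuous_on (M \<times> {0..T}) (\<lambda>z. u (fst z) (snd z))"
  by (intro continuous_on_charts smooth_on_imp_continuous_on smooth_u_chart)

lemma continuous_on_harnack_quantity: "continuous_on (M \<times> {0..T}) (\<lambda>z. harnack_quantity (fst z) (snd z))"
proof (rule continuous_on_charts)
  fix c assume c: "c \<in> A"
  let ?S = "chart_image c \<times> {0..T}"
  have pd: "continuous_on ?S (\<lambda>z. partial_deriv i (logu c (snd z)) (fst z))" for i
    using continuous_on_partial_deriv_slice[OF open_chart_image[OF atlas c] smooth_logu_spacetime[OF c], of i]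
    by (simp add: case_prod_beta')
  have inv: "continuous_on ?S (\<lambda>z. metric_coeff_inv A (g (snd z)) c (fst z) $ i $ j)" for i j
    unfolding metric_coeff_inv_def using det_metric_coeff[OF atlas metric c]
    by (intro continuous_on_matrix_inv metric_coeff_continuous c) auto
  have "continuous_on {0..T} weight"
    using weight_has_derivative by (rule DERIV_continuous_on)
  then have w: "continuous_on ?S (\<lambda>z. weight (snd z))"
    by (rule continuous_on_compose2[OF _ continuous_on_snd[OF continuous_on_id]]) auto
  have "continuous_on ?S (\<lambda>z. weight (snd z) * energy c (snd z) (fst z) + logu c (snd z) (fst z))"
    unfolding energy_def
    by (intro continuous_intros pd inv w smooth_on_imp_continuous_on smooth_logu_spacetime c)
  then show "continuous_on ?S (\<lambda>z. harnack_quantity (chart_inv c (fst z)) (snd z))"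
    by (rule continuous_on_eq) (auto simp: harnack_quantity_chart c)
qed

text \<open>Subtracting \<epsilon> s makes the maximum principle strict. At a maximum over
  \<open>M \<times> {0..t1}\<close> the evolution inequality makes the time derivative of Q
  nonpositive, whereas comparison with earlier times makes it at least \<epsilon>. The restriction
  \<open>t1 < T\<close> keeps the maximum away from the final time, as the evolution inequality
  requires.\<close>

lemma harnack_quantity_le:
  assumes B: "\<And>p. p \<in> M \<Longrightarrow> ln (u p 0) \<le> B" and p1: "p1 \<in> M" and t1: "t1 \<in> {0..<T}"
  shows "harnack_quantity p1 t1 \<le> B"
proof (rule ccontr)
  assume "\<not> ?thesis"
  then have gt: "B < harnack_quantity p1 t1" by simp
  \<comment> \<open>At most half of the excess over \<open>B\<close> is lost at time
    \<open>t1\<close>; the summand 1 keeps the denominator positive when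
    \<open>t1 = 0\<close>.\<close>
  define \<epsilon> where "\<epsilon> = (harnack_quantity p1 t1 - B) / (2 * (t1 + 1))"
  have \<epsilon>: "0 < \<epsilon>" using gt t1 by (simp add: \<epsilon>_def)
  have "\<epsilon> * (2 * (t1 + 1)) = harnack_quantity p1 t1 - B"
    using t1 unfolding \<epsilon>_def by (intro nonzero_eq_divide_eq[THEN iffD1] refl) auto
  then have "2 * (\<epsilon> * t1) + 2 * \<epsilon> = harnack_quantity p1 t1 - B" by (simp add: algebra_simps)
  moreover have "0 \<le> \<epsilon> * t1" using \<epsilon> t1 by simp
  ultimately have B1: "B < harnack_quantity p1 t1 - \<epsilon> * t1" using \<epsilon> by linarith
  have "continuous_on (M \<times> {0..t1}) (\<lambda>z. harnack_quantity (fst z) (snd z) - \<epsilon> * snd z)"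
    using t1 by (intro continuous_intros continuous_on_subset[OF continuous_on_harnack_quantity]) auto
  moreover have "compact (M \<times> {0..t1})" "M \<times> {0..t1} \<noteq> {}"
    using compact p1 t1 by (auto intro: compact_Times)
  ultimately obtain z where z: "z \<in> M \<times> {0..t1}"
    "\<And>y. y \<in> M \<times> {0..t1} \<Longrightarrow> harnack_quantity (fst y) (snd y) - \<epsilon> * snd y \<le> harnack_quantity (fst z) (snd z) - \<epsilon> * snd z"
    using continuous_attains_sup by meson
  obtain p t where pt: "z = (p, t)" by (cases z)
  have max: "harnack_quantity q s - \<epsilon> * s \<le> harnack_quantity p t - \<epsilon> * t" if "q \<in> M" "s \<in> {0..t1}" for q s
    using z(2)[of "(q, s)"] that by (simp add: pt)
  have p: "p \<in> M" and "t \<in> {0..t1}" using z(1) by (auto simp: pt)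
  \<comment> \<open>At time 0 the weight vanishes and Q is ln u, at most \<open>B\<close>, while the
    maximum exceeds \<open>B\<close>.\<close>
  have "t \<noteq> 0"
  proof
    assume "t = 0"
    then have "harnack_quantity p t - \<epsilon> * t \<le> B" using B[OF p] by (simp add: harnack_quantity_def weight_0)
    then show False using max[OF p1, of t1] B1 t1 by simp
  qed
  then have t: "0 < t" "t \<le> t1" "t \<in> {0<..<T}" "t \<in> {0..T}" using \<open>t \<in> {0..t1}\<close> t1 by auto
  obtain c where c: "c \<in> A" "p \<in> fst c"
    using exists_chart[OF atlas p] by (auto simp: charts_at_def)
  define x where "x = snd c p"
  have x: "x \<in> chart_image c" and px: "chart_inv c x = p"
    using snd_in_chart_image[OF c(2)] chart_inv_snd[OF atlas c] by (auto simp: x_def)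
  have "at t within {0..T} = at t"
    using t by (intro at_within_interior) (simp add: interior_atLeastAtMost_real)
  then have "(weight has_real_derivative 1/2 - k t * weight t) (at t)"
    using weight_has_derivative[OF t(4)] by simp
  from evolution_inequality[OF c(1) x t(3) this weight_nonneg[OF t(4)]]
  obtain D where D: "((\<lambda>s. weight s * energy c s x + logu c s x) has_real_derivative D) (at t)"
    "D \<le> levi_civita.lap (\<lambda>i j x. metric_coeff_inv A (g t) c x $ i $ j) (christoffel A (g t) c)
        (\<lambda>y. weight t * energy c t y + logu c t y) x / 2
      + (\<Sum>i\<in>UNIV. (\<Sum>j\<in>UNIV. metric_coeff_inv A (g t) c x $ i $ j * partial_deriv j (logu c t) x) *
          partial_deriv i (\<lambda>y. weight t * energy c t y + logu c t y) x)"
    by blast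
  interpret L: levi_civita "chart_image c" "\<lambda>i j x. metric_coeff_inv A (g t) c x $ i $ j" "christoffel A (g t) c"
    by (rule connection[OF c(1) t(4)])
  let ?Q = "\<lambda>y. weight t * energy c t y + logu c t y"
  have smQ: "smooth_on (chart_image c) ?Q"
    unfolding energy_def by (intro L.smooth_intros smooth_logu c t)
  have "?Q y \<le> ?Q x" if "y \<in> chart_image c" for y
    using max[OF chart_inv_in_M[OF c(1) that], of t] t
    by (simp add: harnack_quantity_chart[OF c(1) that t(4)] harnack_quantity_chart[OF c(1) x t(4)] px[symmetric])
  from L.lap_at_max_nonpos[OF smQ x this metric_coeff_inv_nonneg[OF atlas metric[OF t(4)] c(1) x]]
  have "D \<le> 0" using D(2) by simp
  moreover have "\<epsilon> \<le> D"
  \<comment> \<open>Only times before t are compared, as the maximum may sit at the last time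
    \<open>t1\<close>.\<close>
  proof (rule ccontr)
    assume "\<not> \<epsilon> \<le> D"
    moreover have "((\<lambda>s. (weight s * energy c s x + logu c s x) - \<epsilon> * s) has_real_derivative D - \<epsilon>) (at t)"
      using DERIV_diff[OF D(1) DERIV_cmult_Id[of \<epsilon>]] by simp
    ultimately obtain d where d: "d > 0" "\<And>h. 0 < h \<Longrightarrow> h < d \<Longrightarrow>
        (weight t * energy c t x + logu c t x) - \<epsilon> * t <
        (weight (t - h) * energy c (t - h) x + logu c (t - h) x) - \<epsilon> * (t - h)"
      using DERIV_neg_dec_left[of "\<lambda>s. (weight s * energy c s x + logu c s x) - \<epsilon> * s" "D - \<epsilon>" t] by auto
    define h where "h = min d t / 2"
    have h: "0 < h" "h < d" "h < t" using d(1) t by (auto simp: h_def)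
    have "harnack_quantity p t - \<epsilon> * t < harnack_quantity p (t - h) - \<epsilon> * (t - h)"
      using d(2)[OF h(1,2)] harnack_quantity_chart[OF c(1) x t(4)] harnack_quantity_chart[OF c(1) x, of "t - h"] h t
      by (simp add: px)
    then show False using max[OF p, of "t - h"] h t by simp
  qed
  ultimately show False using \<epsilon> by simp
qed

text \<open>The bound passes to the limit from the left, since Q is continuous up to time
  \<open>T\<close>.\<close>

lemma harnack_quantity_le_end:
  assumes B: "\<And>p. p \<in> M \<Longrightarrow> ln (u p 0) \<le> B" and p: "p \<in> M"
  shows "harnack_quantity p T \<le> B"
proof -
  have "continuous_on {0..T} (\<lambda>t. harnack_quantity p t)"
    using continuous_on_compose2[OF continuous_on_harnack_quantity continuous_on_Pair[OF continuous_on_const continuous_on_id],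
        of p "{0..T}"] p
    by auto
  then have "((\<lambda>t. harnack_quantity p t) \<longlongrightarrow> harnack_quantity p T) (at T within {0..T})"
    using T_pos by (simp add: continuous_on)
  moreover have "\<forall>\<^sub>F t in at T within {0..T}. harnack_quantity p t \<le> B"
    unfolding eventually_at_filter
    by (rule always_eventually) (auto intro!: harnack_quantity_le[OF B p])
  moreover have "at T within {0..T} \<noteq> bot"
    using T_pos by (simp add: trivial_limit_within islimpt_Icc)
  ultimately show ?thesis by (intro tendsto_upperbound)
qed

section \<open>From the bound on Q to the gradient estimate\<close>

lemma u_le_sup_norm:
  assumes "p \<in> M" "t \<in> {0..T}"
  shows "u p t \<le> sup_norm_on (M \<times> {0..T}) u"
proof -
  have "compact ((\<lambda>z. \<bar>u (fst z) (snd z)\<bar>) ` (M \<times> {0..T}))"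
    using compact continuous_on_u by (intro compact_continuous_image continuous_intros compact_Times) auto
  then have "bdd_above ((\<lambda>z. \<bar>u (fst z) (snd z)\<bar>) ` (M \<times> {0..T}))"
    by (intro bounded_imp_bdd_above compact_imp_bounded)
  then have "\<bar>u p t\<bar> \<le> sup_norm_on (M \<times> {0..T}) u"
    unfolding sup_norm_on_def using assms cSUP_upper[of "(p, t)" "M \<times> {0..T}"] by fastforce
  then show ?thesis by simp
qed

lemma gradient_estimate:
  assumes p: "p \<in> M" and t: "t \<in> {0<..T}"
  shows "(metric_norm (g t) p (gradient A (g t) (\<lambda>y. u y t) p))\<^sup>2 / (u p t)\<^sup>2
      \<le> 2 / integral {0..t} (\<lambda>s. exp (- integral {s..t} k))
          * ln (sup_norm_on (M \<times> {0..T}) u / u p t)"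
proof -
  let ?K = "sup_norm_on (M \<times> {0..T}) u"
  let ?R = "(metric_norm (g t) p (gradient A (g t) (\<lambda>y. u y t) p))\<^sup>2 / (u p t)\<^sup>2"
  have upos: "0 < u p t" and "u p t \<le> ?K" using u_pos u_le_sup_norm p t by auto
  then have K: "0 < ?K" by simp
  have "ln (u q 0) \<le> ln ?K" if "q \<in> M" for q
    using u_le_sup_norm[OF that, of 0] u_pos[OF that, of 0] T_pos K by simp
  then have "harnack_quantity p t \<le> ln ?K"
    using harnack_quantity_le[OF _ p, of "ln ?K" t] harnack_quantity_le_end[OF _ p, of "ln ?K"] t
    by (cases "t = T") auto
  then have "weight t * ?R \<le> ln (?K / u p t)"
    using upos K by (simp add: harnack_quantity_def ln_div)
  then have "?R \<le> ln (?K / u p t) / weight t"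
    using weight_pos[OF t] by (simp add: pos_le_divide_eq mult.commute)
  \<comment> \<open>The weight is half the integral in the statement, whence the factor 2.\<close>
  then show ?thesis by (simp add: weight_def mult.commute)
qed

end

theorem theorem2p1:
  fixes M :: "'m::t2_space set"
    and A :: "('m, 'd::finite) chart set"
    and T :: real
    and g :: "real \<Rightarrow> ('m, 'd) bilinear_field"
    and k :: "real \<Rightarrow> real"
    and u :: "'m \<Rightarrow> real \<Rightarrow> real"
  assumes "compact M" and "smooth_atlas M A"
    and "T > 0"
    and "C1_metric_family M A T g"
    and "continuous_on {0..T} k"
    and "\<And>t p c X. t \<in> {0..T} \<Longrightarrow> p \<in> M \<Longrightarrow> c \<in> charts_at A p \<Longrightarrow> X \<in> tangent_space A p \<Longrightarrow>
           ricci A (g t) c p X X + metric_time_deriv T g t p X X \<ge> - k t * g t p X X"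
    and "smooth_spacetime A T u"
    and "\<And>p t. p \<in> M \<Longrightarrow> t \<in> {0..T} \<Longrightarrow> u p t > 0"
    and "heat_solution A T g u"
  shows "\<forall>x\<in>M. \<forall>t\<in>{0<..T}.
    (metric_norm (g t) x (gradient A (g t) (\<lambda>y. u y t) x))\<^sup>2 / (u x t)\<^sup>2
      \<le> 2 / integral {0..t} (\<lambda>s. exp (- integral {s..t} k))
          * ln (sup_norm_on (M \<times> {0..T}) u / u x t)"
proof -
  interpret heat_flow M A T g k u
    by (rule heat_flow.intro[OF assms])
  show ?thesis using gradient_estimate by blast
qed

end
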